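(* Let $1\le p\le d-1$, let $D\subset\mathbb{R}^d$ be an open domain, let $L:\Lambda^p(\mathbb{R}^d)\to\mathbb{R}$ be smooth, and let $\alpha=\sum_{|J|=p}A_J\,dy_J$ be a closed $p$-form on $D$ which is admissible (in the sense given in the context). Then $\alpha$ is a critical point of $$\mathcal{F}[\alpha]=\int_D L(A(y))\,dy$$ in the sense of the second Variational Principle, i.e. $$\left.\frac{d}{d\epsilon}\right|_{\epsilon=0}\mathcal{F}[\phi_\epsilon^*\alpha]=0\quad\text{for every flow }(\phi_\epsilon)_{\epsilon\in\mathbb{R}}\text{ of a vector field }\xi\in C_c^\infty(D)^d,$$ if and only if the tensor $T=(T_{ij})_{1\le i,j\le d}$ defined on $D$ by $$T_{ij}(y):=L(A(y))\,\delta_i^j-\sum_{K\not\ni i,j}(-1)^{q(i,j;K)}A_I(y)\,\frac{\partial L}{\partial A_J}(A(y))$$ is Divergence-free: $$\sum_{j=1}^d\partial_jT_{ij}=0\quad\text{in the sense of distributions on }D,\qquad\forall\,i\in\{1,\dots,d\}.$$ Here the sum runs over the $(p-1)$-subsets $K\subset\{1,\dots,d\}$ containing neither $i$ nor $j$, $I:=K\cup\{i\}$ and $J:=K\cup\{j\}$ are written as increasing $p$-tuples, and $q(i,j;K)$ is the number of indices $k\in K$ that lie between $i$ and $j$.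
   Context: Notation. For an increasing $p$-tuple $J=(j_1<\dots<j_p)$ of elements of $\{1,\dots,d\}$ (identified with a $p$-subset), $dy_J=dy_{j_1}\wedge\dots\wedge dy_{j_p}$. The $dy_J$ form the canonical basis of $\Lambda^p(\mathbb{R}^d)$, the space of alternating $p$-forms with constant coefficients. An element $\sum_J A_Jdy_J$ is identified with its coordinates $A=(A_J)_{|J|=p}$, and $L$ is regarded as a smooth function of these coordinates, with partial derivatives $\partial L/\partial A_J$. For a $p$-form on $D$ the coordinates $A_J$ are functions of $y\in D$; closed means $d\alpha=0$ (in the sense of distributions). The domain $D$ may have arbitrary topology, and $\alpha$ need not be exact. Flows. Given $\xi\in C_c^\infty(D)^d$, its flow $(\phi_\epsilon)_{\epsilon\in\mathbb{R}}$ is the family of diffeomorphisms of $D$ defined by $\frac{d\phi_\epsilon}{d\epsilon}=\xi(\phi_\epsilon)$, $\phi_0=\mathrm{Id}_D$. Pullback. For a diffeomorphism $\phi$ of $D$, $\phi^*\alpha(z)=\sum_I A_I(\phi(z))\,d\phi_{i_1}\wedge\dots\wedge d\phi_{i_p}$. The value $\mathcal{F}[\phi^*\alpha]$ is the integral over $D$ of $L$ evaluated at the coordinates of $\phi^*\alpha$. Admissibility (standing mild assumption). The coordinates $A_J$ are measurable functions on $D$, $\mathcal{F}[\alpha]$ is well defined, the functions $L(A)$ and $A_I\,\frac{\partial L}{\partial A_J}(A)$ occurring in $T$ are locally integrable on $D$, and for every $\xi\in C_c^\infty(D)^d$ with flow $\phi_\epsilon$ the derivative at $\epsilon=0$ of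 $$\mathcal{F}[\phi_\epsilon^*\alpha]=\int_D L\big((\phi_\epsilon^*\alpha)\circ\phi_{-\epsilon}\big)\,\frac{dy}{J(\phi_\epsilon)\circ\phi_{-\epsilon}}$$ exists and can be computed by differentiating under the integral sign. Here $\circ\,\phi_{-\epsilon}$ is composition applied to each coordinate function, and $J(\phi_\epsilon)$ is the Jacobian determinant of $\phi_\epsilon$. *)

theory Defs
  imports "HOL-Analysis.Analysis"
begin

text \<open>
  The index set \<open>{1,\<dots>,d}\<close> is a type \<open>'n\<close> of class \<open>{finite,wellorder}\<close>, with
  \<open>d = CARD('n)\<close>; finite linear orders are well-orders, so the class only provides the linear
  order needed to write subsets as increasing tuples.
\<close>

section \<open>Smooth functions, test functions, distributional derivatives\<close>

definition pdv :: "'a::real_normed_vector \<Rightarrow> ('a \<Rightarrow> real) \<Rightarrow> 'a \<Rightarrow> real"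
  where "pdv b f x = deriv (\<lambda>t. f (x + t *\<^sub>R b)) 0"

text \<open>
  \<open>V\<close> has to be a coordinate subspace, i.e. the span of \<open>Basis \<inter> V\<close>: all partial derivatives up
  to order \<open>k\<close> with respect to the coordinates of \<open>V\<close> exist and are continuous on \<open>V\<close>. The values
  of \<open>f\<close> outside \<open>V\<close> do not matter.
\<close>

primrec Ck_on :: "'a::euclidean_space set \<Rightarrow> nat \<Rightarrow> ('a \<Rightarrow> real) \<Rightarrow> bool" where
  "Ck_on V 0 f \<longleftrightarrow> continuous_on V f"
| "Ck_on V (Suc k) f \<longleftrightarrow> continuous_on V f \<and>
     (\<forall>b\<in>Basis \<inter> V. (\<forall>x\<in>V. (\<lambda>t. f (x + t *\<^sub>R b)) differentiable (at (0::real))) \<and>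
                     Ck_on V k (pdv b f))"

definition smooth_on_coord_subspace :: "'a::euclidean_space set \<Rightarrow> ('a \<Rightarrow> real) \<Rightarrow> bool"
  where "smooth_on_coord_subspace V f \<longleftrightarrow> (\<forall>k. Ck_on V k f)"

text \<open>The space \<open>C_c^\<infinity>(D)\<close>, its elements being extended by zero to the whole space.\<close>

definition test_functions :: "'a::euclidean_space set \<Rightarrow> ('a \<Rightarrow> real) set"
  where "test_functions D =
    {f. smooth_on_coord_subspace UNIV f \<and>
        compact (closure (support_on UNIV f)) \<and> closure (support_on UNIV f) \<subseteq> D}"

definition test_fields :: "(real^'n) set \<Rightarrow> (real^'n \<Rightarrow> real^'n) set"
  where "test_fields D = {\<xi>. \<forall>i. (\<lambda>y. \<xi> y $ i) \<in> test_functions D}"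

definition locally_integrable :: "'a::euclidean_space set \<Rightarrow> ('a \<Rightarrow> real) \<Rightarrow> bool"
  where "locally_integrable D f \<longleftrightarrow>
    (\<forall>K. compact K \<and> K \<subseteq> D \<longrightarrow> set_integrable lebesgue K f)"

text \<open>The value \<open>\<langle>\<partial>\<^sub>j f, \<psi>\<rangle>\<close>, meaningful for locally integrable \<open>f\<close> and test functions \<open>\<psi>\<close> on \<open>D\<close>.\<close>

definition distr_pd :: "(real^'n) set \<Rightarrow> 'n \<Rightarrow> (real^'n \<Rightarrow> real) \<Rightarrow> (real^'n \<Rightarrow> real) \<Rightarrow> real"
  where "distr_pd D j f \<psi> = - (LINT y:D|lebesgue. f y * pdv (axis j 1) \<psi> y)"

definition distr_divergence_free ::
    "(real^'n) set \<Rightarrow> ('n \<Rightarrow> 'n \<Rightarrow> real^'n \<Rightarrow> real) \<Rightarrow> bool"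
  where "distr_divergence_free D T \<longleftrightarrow>
    (\<forall>i. \<forall>\<psi>\<in>test_functions D. (\<Sum>j\<in>UNIV. distr_pd D j (T i j) \<psi>) = 0)"

section \<open>Forms in coordinates\<close>

text \<open>
  A constant-coefficient \<open>p\<close>-form \<open>\<Sum>\<^sub>J A\<^sub>J dy\<^sub>J\<close> is the family \<open>A\<close> of its coordinates, indexed by all
  subsets \<open>J\<close> of the index set and vanishing when \<open>J\<close> does not have \<open>p\<close> elements. So \<open>Lam p\<close>
  is a coordinate subspace with one coordinate for every \<open>p\<close>-subset.
\<close>

definition Lam :: "nat \<Rightarrow> (real^('n::finite set)) set"
  where "Lam p = {A. \<forall>J. card J \<noteq> p \<longrightarrow> A $ J = 0}"

text \<open>
  Coordinates of \<open>w\<^sub>0 \<and> \<dots> \<and> w\<^sub>p\<^sub>-\<^sub>1\<close> for covectors \<open>w\<^sub>k = \<Sum>\<^sub>j (w k $ j) dy\<^sub>j\<close>: the coefficient of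
  \<open>dy\<^sub>J\<close> is the determinant of the \<open>p \<times> p\<close> matrix with entries \<open>w k $ j\<^sub>l\<close>, \<open>J = (j\<^sub>0 < \<dots> < j\<^sub>p\<^sub>-\<^sub>1)\<close>.
\<close>

definition wedge :: "nat \<Rightarrow> (nat \<Rightarrow> real^'n::{finite,wellorder}) \<Rightarrow> real^('n set)"
  where "wedge p w = (\<chi> J. if card J = p
    then \<Sum>\<pi> | \<pi> permutes {..<p}.
           of_int (sign \<pi>) * (\<Prod>k<p. w k $ (sorted_list_of_set J ! \<pi> k))
    else 0)"

text \<open>Row \<open>i\<close> of the Jacobian matrix is \<open>d\<phi>\<^sub>i\<close>.\<close>

definition pullback :: "nat \<Rightarrow> (real^'n::{finite,wellorder} \<Rightarrow> real^'n::_) \<Rightarrow>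
    (real^'n::_ \<Rightarrow> real^('n set)) \<Rightarrow> real^'n::_ \<Rightarrow> real^('n set)"
  where "pullback p \<phi> A z =
    (\<Sum>I | card I = p.
       (A (\<phi> z) $ I) *\<^sub>R wedge p (\<lambda>k. jacobian \<phi> (at z) $ (sorted_list_of_set I ! k)))"

text \<open>
  Closedness in the sense of distributions: the coefficient of \<open>dy\<^sub>M\<close> in
  \<open>d\<alpha> = \<Sum>\<^sub>J \<Sum>\<^sub>j \<partial>\<^sub>j A\<^sub>J dy\<^sub>j \<and> dy\<^sub>J\<close> collects the pairs with \<open>j \<in> M\<close> and \<open>J = M - {j}\<close>, where
  \<open>dy\<^sub>j \<and> dy\<^sub>J = (-1)^{#{k \<in> M. k < j}} dy\<^sub>M\<close>. Local integrability makes the coordinates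
  distributions.
\<close>

definition closed_form ::
    "nat \<Rightarrow> (real^'n::{finite,wellorder}) set \<Rightarrow> (real^'n::_ \<Rightarrow> real^('n set)) \<Rightarrow> bool"
  where "closed_form p D A \<longleftrightarrow>
    (\<forall>J. card J = p \<longrightarrow> locally_integrable D (\<lambda>y. A y $ J)) \<and>
    (\<forall>M. card M = p + 1 \<longrightarrow> (\<forall>\<psi>\<in>test_functions D.
       (\<Sum>j\<in>M. (-1) ^ card {k\<in>M. k < j} * distr_pd D j (\<lambda>y. A y $ (M - {j})) \<psi>) = 0))"

section \<open>The functional, its variations along flows, and the tensor\<close>

definition functional :: "(real^'n::{finite,wellorder}) set \<Rightarrow> (real^('n set) \<Rightarrow> real) \<Rightarrow>
    (real^'n::_ \<Rightarrow> real^('n set)) \<Rightarrow> real"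
  where "functional D L A = (LINT y:D|lebesgue. L (A y))"

text \<open>
  \<open>\<phi> \<epsilon>\<close> matters on \<open>D\<close> only, where the equation determines it; that it is a diffeomorphism of \<open>D\<close>
  with inverse \<open>\<phi> (- \<epsilon>)\<close> is a consequence and not part of the definition.
\<close>

definition is_flow_of ::
    "(real \<Rightarrow> real^'n \<Rightarrow> real^'n) \<Rightarrow> (real^'n \<Rightarrow> real^'n) \<Rightarrow> (real^'n) set \<Rightarrow> bool"
  where "is_flow_of \<phi> \<xi> D \<longleftrightarrow>
    (\<forall>y\<in>D. \<phi> 0 y = y \<and>
       (\<forall>\<epsilon>. \<phi> \<epsilon> y \<in> D \<and> ((\<lambda>e. \<phi> e y) has_vector_derivative \<xi> (\<phi> \<epsilon> y)) (at \<epsilon>)))"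

definition critical_second_principle :: "nat \<Rightarrow> (real^'n::{finite,wellorder}) set \<Rightarrow>
    (real^('n set) \<Rightarrow> real) \<Rightarrow> (real^'n::_ \<Rightarrow> real^('n set)) \<Rightarrow> bool"
  where "critical_second_principle p D L A \<longleftrightarrow>
    (\<forall>\<xi>\<in>test_fields D. \<forall>\<phi>. is_flow_of \<phi> \<xi> D \<longrightarrow>
       ((\<lambda>\<epsilon>. functional D L (pullback p (\<phi> \<epsilon>) A)) has_real_derivative 0) (at 0))"

text \<open>
  The derivative at \<open>0\<close> of \<open>\<epsilon> \<mapsto> \<integral>\<^sub>D g \<epsilon> y dy\<close> exists and is obtained by differentiating under the
  integral sign.
\<close>

definition diff_under_integral_at_0 ::
    "'a::euclidean_space set \<Rightarrow> (real \<Rightarrow> 'a \<Rightarrow> real) \<Rightarrow> bool"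
  where "diff_under_integral_at_0 D g \<longleftrightarrow>
    (\<forall>\<^sub>F \<epsilon> in nhds 0. set_integrable lebesgue D (g \<epsilon>)) \<and>
    (AE y\<in>D in lebesgue. (\<lambda>\<epsilon>. g \<epsilon> y) differentiable (at 0)) \<and>
    set_integrable lebesgue D (\<lambda>y. deriv (\<lambda>\<epsilon>. g \<epsilon> y) 0) \<and>
    ((\<lambda>\<epsilon>. LINT y:D|lebesgue. g \<epsilon> y)
       has_real_derivative (LINT y:D|lebesgue. deriv (\<lambda>\<epsilon>. g \<epsilon> y) 0)) (at 0)"

text \<open>Integrand of \<open>F[\<phi>\<^sub>\<epsilon>\<^sup>*\<alpha>]\<close> after the change of variables \<open>z = \<phi>\<^sub>-\<^sub>\<epsilon>(y)\<close>.\<close>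

definition transported_integrand :: "nat \<Rightarrow> (real^('n set) \<Rightarrow> real) \<Rightarrow>
    (real^'n::{finite,wellorder} \<Rightarrow> real^('n set)) \<Rightarrow> (real \<Rightarrow> real^'n::_ \<Rightarrow> real^'n::_) \<Rightarrow>
    real \<Rightarrow> real^'n::_ \<Rightarrow> real"
  where "transported_integrand p L A \<phi> \<epsilon> y =
    L (pullback p (\<phi> \<epsilon>) A (\<phi> (- \<epsilon>) y)) / det (jacobian (\<phi> \<epsilon>) (at (\<phi> (- \<epsilon>) y)))"

definition admissible :: "nat \<Rightarrow> (real^'n::{finite,wellorder}) set \<Rightarrow>
    (real^('n set) \<Rightarrow> real) \<Rightarrow> (real^'n::_ \<Rightarrow> real^('n set)) \<Rightarrow> bool"
  where "admissible p D L A \<longleftrightarrow>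
    (\<forall>J. card J = p \<longrightarrow> (\<lambda>y. A y $ J) \<in> borel_measurable (lebesgue_on D)) \<and>
    set_integrable lebesgue D (\<lambda>y. L (A y)) \<and>
    locally_integrable D (\<lambda>y. L (A y)) \<and>
    (\<forall>i j K. card K = p - 1 \<and> i \<notin> K \<and> j \<notin> K \<longrightarrow>
       locally_integrable D (\<lambda>y. A y $ insert i K * pdv (axis (insert j K) 1) L (A y))) \<and>
    (\<forall>\<xi>\<in>test_fields D. \<forall>\<phi>. is_flow_of \<phi> \<xi> D \<longrightarrow>
       diff_under_integral_at_0 D (transported_integrand p L A \<phi>))"

definition between_count :: "'n::linorder \<Rightarrow> 'n \<Rightarrow> 'n set \<Rightarrow> nat"
  where "between_count i j K = card {k\<in>K. (i < k \<and> k < j) \<or> (j < k \<and> k < i)}"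

definition T_tensor :: "nat \<Rightarrow> (real^('n set) \<Rightarrow> real) \<Rightarrow>
    (real^'n::{finite,wellorder} \<Rightarrow> real^('n set)) \<Rightarrow> 'n \<Rightarrow> 'n \<Rightarrow> real^'n::_ \<Rightarrow> real"
  where "T_tensor p L A i j y =
    L (A y) * (if i = j then 1 else 0) -
    (\<Sum>K | card K = p - 1 \<and> i \<notin> K \<and> j \<notin> K.
       (-1) ^ between_count i j K * (A y $ insert i K) * pdv (axis (insert j K) 1) L (A y))"

end

theory Submission
  imports Defs
begin

text \<open>
  The reason for the theorem is that, after a change of variables, only the Jacobian matrix of the
  flow depends on \<open>\<epsilon>\<close>. Substituting \<open>z = \<phi>\<^sub>-\<^sub>\<epsilon>(y)\<close> turns \<open>F[\<phi>\<^sub>\<epsilon>\<^sup>*\<alpha>]\<close> into the integral over \<open>D\<close> of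
  \<open>L((\<phi>\<^sub>\<epsilon>\<^sup>*\<alpha>)(\<phi>\<^sub>-\<^sub>\<epsilon>(y))) / det W(\<epsilon>)\<close>, where \<open>W(\<epsilon>) = D\<phi>\<^sub>\<epsilon>(\<phi>\<^sub>-\<^sub>\<epsilon>(y))\<close>.
  Since \<open>\<phi>\<^sub>\<epsilon>(\<phi>\<^sub>-\<^sub>\<epsilon>(y)) = y\<close>, the coordinates of the form inside \<open>L\<close> are
  \<open>B\<^sub>J(\<epsilon>) = \<Sum>\<^sub>I A\<^sub>I(y) det W(\<epsilon>)[I,J]\<close>, with the coefficients \<open>A\<^sub>I(y)\<close> frozen at \<open>y\<close>, so that
  a derivative in \<open>\<epsilon>\<close> never falls on \<open>A\<close>.

  At \<open>\<epsilon> = 0\<close> one has \<open>W = 1\<close> and \<open>W' = D\<xi>(y)\<close>. The derivative of the minor \<open>W[I,J]\<close> at the identity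
  matrix involves an entry \<open>\<partial>\<^sub>j\<xi>\<^sub>i\<close> exactly when \<open>I = K \<union> {i}\<close> and \<open>J = K \<union> {j}\<close> for a common \<open>K\<close>, and
  then with the sign of the permutation that moves the position of \<open>i\<close> in \<open>I\<close> to the position of
  \<open>j\<close> in \<open>J\<close> and keeps \<open>K\<close> in order. That permutation is a cycle passing over the elements of \<open>K\<close>
  between \<open>i\<close> and \<open>j\<close>, which is where \<open>(-1)^q(i,j;K)\<close> comes from
  (\<open>minor_has_real_derivative_at_mat_1\<close>). The factor \<open>1 / det W\<close> contributes \<open>- div \<xi>\<close>. The chain rule
  gives the pointwise derivative \<open>- \<Sum>\<^sub>i\<^sub>j T\<^sub>i\<^sub>j \<partial>\<^sub>j\<xi>\<^sub>i\<close> (\<open>transported_integrand_has_derivative\<close>), and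
  admissibility allows it to be integrated:
  the first variation along \<open>\<xi>\<close> is \<open>\<Sum>\<^sub>i\<^sub>j \<langle>\<partial>\<^sub>j T\<^sub>i\<^sub>j, \<xi>\<^sub>i\<rangle>\<close> (\<open>first_variation\<close>). It vanishes for all
  \<open>\<xi>\<close> iff it vanishes for the fields \<open>\<psi> e\<^sub>i\<close>, i.e. iff \<open>T\<close> is divergence-free.

  The analytic work is to make the flow available. Fields \<open>\<psi> e\<^sub>i\<close> only give information if they have
  a flow, and the change of variables requires \<open>\<phi>\<^sub>\<epsilon>\<close> to be a differentiable bijection of \<open>D\<close>.
  Existence comes from a Picard operator that is a contraction on all of \<open>\<real>\<close> at once in an
  exponentially weighted norm (\<open>global_solution_exists\<close>). A field that vanishes off \<open>D\<close> cannot move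
  points out of \<open>D\<close>. Differentiability in the initial point, with \<open>D\<phi>\<^sub>t\<close> solving the variational
  equation \<open>v' = D\<xi>(\<phi>\<^sub>t) v\<close>, comes from Gronwall estimates (\<open>flow_has_derivative\<close>).
\<close>

section \<open>Continuous partial derivatives and test functions\<close>

lemma pdv_has_real_derivative_along:
  assumes V: "subspace V" "b \<in> V" "x \<in> V"
    and diff: "\<And>x. x \<in> V \<Longrightarrow> (\<lambda>t. f (x + t *\<^sub>R b)) differentiable (at (0::real))"
  shows "((\<lambda>t. f (x + t *\<^sub>R b)) has_real_derivative pdv b f (x + s *\<^sub>R b)) (at s)"
proof -
  have "x + s *\<^sub>R b \<in> V" using V by (simp add: subspace_add subspace_scale)
  from diff[OF this]
  have "((\<lambda>t. f (x + s *\<^sub>R b + t *\<^sub>R b)) has_real_derivative pdv b f (x + s *\<^sub>R b)) (at 0)"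
    unfolding pdv_def using DERIV_deriv_iff_real_differentiable by blast
  then have "((\<lambda>t. f (x + (t + s) *\<^sub>R b)) has_real_derivative pdv b f (x + s *\<^sub>R b)) (at 0)"
    by (simp add: algebra_simps)
  then show ?thesis using DERIV_shift[of "\<lambda>t. f (x + t *\<^sub>R b)" _ 0 s] by simp
qed

text \<open>
  The step from \<open>x\<close> to \<open>x + h\<close> is made along one coordinate at a time. The mean value theorem
  controls each of these moves, and all intermediate points stay within \<open>\<delta>\<close> of \<open>x\<close> because their
  displacement is componentwise bounded by \<open>h\<close>.
\<close>

lemma increment_along_basis_bound:
  fixes f :: "'a::euclidean_space \<Rightarrow> real"
  assumes V: "subspace V" and x: "x \<in> V"
    and diff: "\<And>b x. b \<in> Basis \<inter> V \<Longrightarrow> x \<in> V \<Longrightarrow>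
      (\<lambda>t. f (x + t *\<^sub>R b)) differentiable (at (0::real))"
    and close: "\<And>b z. b \<in> Basis \<inter> V \<Longrightarrow> z \<in> V \<Longrightarrow> norm (z - x) < \<delta> \<Longrightarrow>
      \<bar>pdv b f z - pdv b f x\<bar> \<le> e"
    and S: "S \<subseteq> Basis \<inter> V" and h: "\<And>b. b \<in> Basis - S \<Longrightarrow> h \<bullet> b = 0" "norm h < \<delta>"
  shows "\<bar>f (x + h) - f x - (\<Sum>b\<in>S. (h \<bullet> b) * pdv b f x)\<bar> \<le> e * (\<Sum>b\<in>S. \<bar>h \<bullet> b\<bar>)"
proof -
  have "finite S" using S finite_Basis finite_subset by blast
  then show ?thesis using S h
  proof (induction S arbitrary: h rule: finite_induct)
    case empty
    then have "h = 0" by (subst euclidean_eq_iff) simp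
    then show ?case by simp
  next
    case (insert b S)
    define t where "t = h \<bullet> b"
    define h' where "h' = h - t *\<^sub>R b"
    have b: "b \<in> Basis" "b \<in> V" using insert by auto
    have h'b: "h' \<bullet> c = (if c = b then 0 else h \<bullet> c)" if "c \<in> Basis" for c
      using that b by (auto simp: h'_def t_def inner_diff_left inner_Basis)
    have nrm: "norm (h' + s *\<^sub>R b) \<le> norm h" if "\<bar>s\<bar> \<le> \<bar>t\<bar>" for s :: real
      using that b h'b
      by (intro norm_le_componentwise) (auto simp: inner_add_left inner_Basis t_def)
    have "norm h' \<le> norm h" using nrm[of 0] by simp
    then have IH: "\<bar>f (x + h') - f x - (\<Sum>b\<in>S. (h' \<bullet> b) * pdv b f x)\<bar> \<le> e * (\<Sum>b\<in>S. \<bar>h' \<bullet> b\<bar>)"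
      using insert by (intro insert.IH) (auto simp: h'b)
    have "h = (\<Sum>c\<in>insert b S. (h \<bullet> c) *\<^sub>R c)"
      using insert.prems insert.hyps
      by (subst (1) euclidean_representation[symmetric], intro sum.mono_neutral_right) auto
    also have "\<dots> \<in> V" using insert.prems(1) V by (intro subspace_sum subspace_scale) auto
    finally have "h' \<in> V" using V b by (auto simp: h'_def intro!: subspace_diff subspace_scale)
    then have xh': "x + h' \<in> V" using V x subspace_add by blast
    \<comment> \<open>Subtracting the linear part leaves a function with derivative at most \<open>e\<close> along the last coordinate.\<close>
    define g where "g s = f (x + h' + s *\<^sub>R b) - s * pdv b f x" for s
    have "norm (g t - g 0) \<le> e * norm (t - 0)"
    proof (rule field_differentiable_bound[where S = "cball 0 \<bar>t\<bar>"])
      fix s :: real assume "s \<in> cball 0 \<bar>t\<bar>"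
      then have s: "\<bar>s\<bar> \<le> \<bar>t\<bar>" by simp
      show "(g has_real_derivative (pdv b f (x + h' + s *\<^sub>R b) - pdv b f x)) (at s within cball 0 \<bar>t\<bar>)"
        unfolding g_def using b diff V xh'
        by (auto intro!: derivative_eq_intros DERIV_subset[OF pdv_has_real_derivative_along[of V]])
      have "x + h' + s *\<^sub>R b \<in> V" using xh' V b by (simp add: subspace_add subspace_scale)
      moreover have "norm (x + h' + s *\<^sub>R b - x) < \<delta>"
        using nrm[OF s] insert.prems by (simp add: algebra_simps)
      ultimately show "norm (pdv b f (x + h' + s *\<^sub>R b) - pdv b f x) \<le> e"
        using close[of b] b by simp
    qed auto
    moreover have "g t = f (x + h) - t * pdv b f x" "g 0 = f (x + h')"
      by (simp_all add: g_def h'_def)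
    ultimately have "\<bar>f (x + h) - f (x + h') - t * pdv b f x\<bar> \<le> e * \<bar>t\<bar>"
      by (simp add: algebra_simps)
    moreover have "(\<Sum>c\<in>S. (h' \<bullet> c) * pdv c f x) = (\<Sum>c\<in>S. (h \<bullet> c) * pdv c f x)"
      "(\<Sum>c\<in>S. \<bar>h' \<bullet> c\<bar>) = (\<Sum>c\<in>S. \<bar>h \<bullet> c\<bar>)"
      using insert by (auto intro!: sum.cong simp: h'b)
    ultimately show ?case using IH insert.hyps by (simp add: t_def algebra_simps)
  qed
qed

text \<open>
  Continuity of the partial derivatives of \<open>f\<close> at \<open>x\<close> makes the error in
  \<open>increment_along_basis_bound\<close> of order \<open>o(norm h)\<close>. The derivative is taken within \<open>V\<close>, since
  nothing is known about \<open>f\<close> elsewhere; this is the form that the Lagrangian on \<open>Lam p\<close> needs.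
\<close>

lemma Ck_on_imp_has_derivative_within:
  fixes f :: "'a::euclidean_space \<Rightarrow> real"
  assumes V: "subspace V" "\<And>v b. v \<in> V \<Longrightarrow> b \<in> Basis - V \<Longrightarrow> v \<bullet> b = 0"
    and f: "Ck_on V (Suc 0) f" and x: "x \<in> V"
  shows "(f has_derivative (\<lambda>h. \<Sum>b\<in>Basis \<inter> V. (h \<bullet> b) * pdv b f x)) (at x within V)"
  unfolding has_derivative_within_alt
proof (intro conjI allI impI)
  show "bounded_linear (\<lambda>h. \<Sum>b\<in>Basis \<inter> V. (h \<bullet> b) * pdv b f x)"
    by (intro bounded_linear_sum bounded_linear_mult_const bounded_linear_inner_left)
next
  fix e :: real assume e: "e > 0"
  have diff: "(\<lambda>t. f (x + t *\<^sub>R b)) differentiable (at (0::real))" if "b \<in> Basis \<inter> V" "x \<in> V" for b x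
    using f that by auto
  \<comment> \<open>The error bound sums \<open>\<bar>h \<bullet> b\<bar>\<close> over at most \<open>DIM\<close> basis vectors.\<close>
  define e' where "e' = e / real (DIM('a))"
  have e': "e' > 0" using e by (simp add: e'_def)
  have "\<forall>\<^sub>F z in at x within V. \<forall>b\<in>Basis \<inter> V. dist (pdv b f z) (pdv b f x) < e'"
  proof (rule eventually_ball_finite)
    show "\<forall>b\<in>Basis \<inter> V. \<forall>\<^sub>F z in at x within V. dist (pdv b f z) (pdv b f x) < e'"
      using f x e' by (auto simp: continuous_on_def tendsto_iff)
  qed auto
  then obtain \<delta> where \<delta>: "\<delta> > 0" "\<And>z b. z \<in> V \<Longrightarrow> z \<noteq> x \<Longrightarrow> dist z x < \<delta> \<Longrightarrow> b \<in> Basis \<inter> V \<Longrightarrow>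
      dist (pdv b f z) (pdv b f x) < e'"
    unfolding eventually_at by blast
  have close: "\<bar>pdv b f z - pdv b f x\<bar> \<le> e'" if "b \<in> Basis \<inter> V" "z \<in> V" "norm (z - x) < \<delta>" for b z
    using \<delta>(2)[of z b] that e' by (cases "z = x") (auto simp: dist_norm)
  show "\<exists>d>0. \<forall>y\<in>V. norm (y - x) < d \<longrightarrow>
      norm (f y - f x - (\<Sum>b\<in>Basis \<inter> V. ((y - x) \<bullet> b) * pdv b f x)) \<le> e * norm (y - x)"
  proof (intro exI[of _ \<delta>] conjI ballI impI)
    fix y assume y: "y \<in> V" "norm (y - x) < \<delta>"
    have "\<bar>f (x + (y - x)) - f x - (\<Sum>b\<in>Basis \<inter> V. ((y - x) \<bullet> b) * pdv b f x)\<bar>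
        \<le> e' * (\<Sum>b\<in>Basis \<inter> V. \<bar>(y - x) \<bullet> b\<bar>)"
    proof (rule increment_along_basis_bound[OF V(1) x diff close order_refl])
      show "(y - x) \<bullet> b = 0" if "b \<in> Basis - Basis \<inter> V" for b
        using that V(2)[of "y - x" b] subspace_diff[OF V(1) y(1) x] by auto
    qed (use y in auto)
    also have "\<dots> \<le> e' * (\<Sum>b\<in>(Basis :: 'a set). norm (y - x))"
      using e' by (intro mult_left_mono order_trans[OF sum_mono2 sum_mono]) (auto intro: Basis_le_norm)
    also have "\<dots> = e * norm (y - x)" by (simp add: e'_def)
    finally show "norm (f y - f x - (\<Sum>b\<in>Basis \<inter> V. ((y - x) \<bullet> b) * pdv b f x)) \<le> e * norm (y - x)"
      by simp
  qed (use \<delta> in auto)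
qed

lemma smooth_imp_pdv_smooth:
  "smooth_on_coord_subspace V f \<Longrightarrow> b \<in> Basis \<inter> V \<Longrightarrow> smooth_on_coord_subspace V (pdv b f)"
  unfolding smooth_on_coord_subspace_def by (metis Ck_on.simps(2))

lemma smooth_imp_has_derivative:
  fixes f :: "real^'n \<Rightarrow> real"
  assumes "smooth_on_coord_subspace UNIV f"
  shows "(f has_derivative (\<lambda>h. \<Sum>j\<in>UNIV. h $ j * pdv (axis j 1) f x)) (at x)"
proof -
  have B: "(Basis :: (real^'n) set) = (\<lambda>j. axis j 1) ` UNIV"
    by (auto simp: Basis_vec_def)
  have inj: "inj (\<lambda>j::'n. axis j (1::real))" by (auto simp: inj_on_def axis_eq_axis)
  have "Ck_on UNIV (Suc 0) f" using assms unfolding smooth_on_coord_subspace_def by blast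
  from Ck_on_imp_has_derivative_within[OF _ _ this, of x] show ?thesis
    by (simp add: B sum.reindex[OF inj] inner_axis subspace_UNIV)
qed

lemma test_function_eq_0:
  assumes "f \<in> test_functions D" "x \<notin> closure (support_on UNIV f)"
  shows "f x = 0"
  using assms closure_subset[of "support_on UNIV f"] by (auto simp: support_on_def)

lemma pdv_eq_0_outside_support:
  assumes x: "x \<notin> closure (support_on UNIV f)"
  shows "pdv b f x = 0"
proof -
  let ?S = "closure (support_on UNIV f)"
  have z: "f y = 0" if "y \<notin> ?S" for y
    using that closure_subset[of "support_on UNIV f"] by (auto simp: support_on_def)
  have "((\<lambda>t. x + t *\<^sub>R b) \<longlongrightarrow> x + 0 *\<^sub>R b) (nhds 0)"
    by (intro tendsto_add tendsto_scaleR tendsto_const filterlim_ident)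
  then have "\<forall>\<^sub>F t in nhds (0::real). x + t *\<^sub>R b \<in> - ?S"
    by (rule topological_tendstoD) (use x in auto)
  then have "\<forall>\<^sub>F t in nhds (0::real). f (x + t *\<^sub>R b) = 0"
    by eventually_elim (use z in auto)
  then have "deriv (\<lambda>t. f (x + t *\<^sub>R b)) 0 = deriv (\<lambda>t. 0) 0"
    by (intro deriv_cong_ev) auto
  then show ?thesis by (simp add: pdv_def)
qed

lemma pdv_test_function:
  assumes f: "f \<in> test_functions D" and b: "b \<in> Basis"
  shows "pdv b f \<in> test_functions D"
proof -
  let ?S = "closure (support_on UNIV f)"
  have "support_on UNIV (pdv b f) \<subseteq> ?S"
    using pdv_eq_0_outside_support by (auto simp: support_on_def)
  then have sub: "closure (support_on UNIV (pdv b f)) \<subseteq> ?S" by (intro closure_minimal) auto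
  have "compact (closure (support_on UNIV (pdv b f)))"
    using sub f bounded_subset by (auto simp: test_functions_def compact_eq_bounded_closed)
  then show ?thesis
    using sub f smooth_imp_pdv_smooth[of UNIV f b] b by (auto simp: test_functions_def)
qed

lemma test_function_continuous_on: "f \<in> test_functions D \<Longrightarrow> continuous_on UNIV f"
  unfolding test_functions_def smooth_on_coord_subspace_def using Ck_on.simps(1) by blast

lemma test_function_bounded:
  assumes f: "f \<in> test_functions D"
  obtains B where "\<And>x. \<bar>f x\<bar> \<le> B"
proof -
  let ?S = "closure (support_on UNIV f)"
  have "compact (f ` ?S)"
    using f by (intro compact_continuous_image continuous_on_subset[OF test_function_continuous_on])
      (auto simp: test_functions_def)
  then obtain B where B: "\<And>x. x \<in> ?S \<Longrightarrow> \<bar>f x\<bar> \<le> B"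
    using compact_imp_bounded bounded_iff[of "f ` ?S"] by auto
  have "\<bar>f x\<bar> \<le> max B 0" for x
    using B[of x] test_function_eq_0[OF f, of x] by (cases "x \<in> ?S") auto
  then show ?thesis using that by blast
qed

lemma test_function_has_derivative:
  fixes f :: "real^'n \<Rightarrow> real"
  assumes "f \<in> test_functions D"
  shows "(f has_derivative (\<lambda>h. \<Sum>j\<in>UNIV. h $ j * pdv (axis j 1) f x)) (at x)"
  using assms by (intro smooth_imp_has_derivative) (auto simp: test_functions_def)

lemma sum_components_bound:
  fixes h :: "real^'n"
  assumes "\<And>j. \<bar>c j\<bar> \<le> B j"
  shows "\<bar>\<Sum>j\<in>UNIV. h $ j * c j\<bar> \<le> (\<Sum>j\<in>UNIV. B j) * norm h"
proof -
  have "\<bar>h $ j * c j\<bar> \<le> B j * norm h" for j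
    unfolding abs_mult using mult_mono[OF assms component_le_norm_cart[of h j]] assms[of j]
    by (simp add: mult.commute)
  then show ?thesis
    unfolding sum_distrib_right by (intro order_trans[OF sum_abs] sum_mono) simp
qed

text \<open>
  Partial derivatives of test functions are again test functions, hence bounded. Applied to a test
  function and to its partial derivatives, this yields the two Lipschitz bounds in \<open>C11_field\<close>.
\<close>

lemma test_function_lipschitz:
  fixes f :: "real^'n \<Rightarrow> real"
  assumes f: "f \<in> test_functions D"
  obtains K where "0 \<le> K" "\<And>x y. \<bar>f x - f y\<bar> \<le> K * norm (x - y)"
proof -
  have "\<exists>B. \<forall>x. \<bar>pdv (axis j 1) f x\<bar> \<le> B" for j
  proof -
    have "axis j 1 \<in> (Basis :: (real^'n) set)" by simp
    from test_function_bounded[OF pdv_test_function[OF f this]] show ?thesis by metis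
  qed
  then obtain B where B: "\<And>j x. \<bar>pdv (axis j 1) f x\<bar> \<le> B j" by metis
  have "norm (f x - f y) \<le> (\<Sum>j\<in>UNIV. B j) * norm (x - y)" for x y
  proof (rule differentiable_bound[OF convex_UNIV])
    show "(f has_derivative (\<lambda>h. \<Sum>j\<in>UNIV. h $ j * pdv (axis j 1) f x)) (at x within UNIV)" for x
      using test_function_has_derivative[OF f] by simp
    show "onorm (\<lambda>h. \<Sum>j\<in>UNIV. h $ j * pdv (axis j 1) f x) \<le> (\<Sum>j\<in>UNIV. B j)" for x
      by (intro onorm_le) (unfold real_norm_def, intro sum_components_bound B)
  qed auto
  moreover have "0 \<le> (\<Sum>j\<in>UNIV. B j)"
    by (intro sum_nonneg order_trans[OF abs_ge_zero B])
  ultimately show ?thesis using that by auto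
qed

section \<open>Gronwall estimates and global solutions of ordinary differential equations\<close>

text \<open>
  The function \<open>(u + b) exp(-k s)\<close> is nonincreasing; \<open>k \<ge> 1\<close> lets the constant \<open>b\<close> be absorbed as
  \<open>b \<le> k b\<close>.
\<close>

lemma gronwall_affine:
  fixes u :: "real \<Rightarrow> real"
  assumes t: "0 \<le> t"
    and u: "\<And>s. 0 \<le> s \<Longrightarrow> s \<le> t \<Longrightarrow> (u has_real_derivative u' s) (at s)"
    and u': "\<And>s. 0 \<le> s \<Longrightarrow> s \<le> t \<Longrightarrow> u' s \<le> k * u s + b"
    and kb: "1 \<le> k" "0 \<le> b"
  shows "u t \<le> (u 0 + b) * exp (k * t)"
proof -
  define w where "w s = (u s + b) * exp (- k * s)" for s
  have "w t \<le> w 0"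
  proof (rule DERIV_nonpos_imp_nonincreasing[OF t], intro exI conjI)
    fix s assume s: "0 \<le> s" "s \<le> t"
    show "(w has_real_derivative (u' s - k * (u s + b)) * exp (- k * s)) (at s)"
      unfolding w_def by (auto intro!: derivative_eq_intros u s simp: algebra_simps)
    have "b \<le> k * b" using kb mult_right_mono[of 1 k b] by simp
    then have "u' s - k * (u s + b) \<le> 0" using u'[OF s] by (simp add: algebra_simps)
    then show "(u' s - k * (u s + b)) * exp (- k * s) \<le> 0" by (simp add: mult_nonpos_nonneg)
  qed
  then have "(u t + b) * exp (- k * t) * exp (k * t) \<le> (u 0 + b) * exp (k * t)"
    by (intro mult_right_mono) (auto simp: w_def)
  then have "u t + b \<le> (u 0 + b) * exp (k * t)"
    by (simp add: mult.assoc flip: exp_add)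
  then show ?thesis using kb by simp
qed

text \<open>
  The squared norm is used because, unlike the norm, it is differentiable at zeros of \<open>w\<close>.
  By Cauchy-Schwarz and \<open>2 c norm w \<le> (norm w)\<^sup>2 + c\<^sup>2\<close> it satisfies the hypothesis of
  \<open>gronwall_affine\<close>.
\<close>

lemma gronwall_norm_forward:
  fixes w :: "real \<Rightarrow> 'a::real_inner"
  assumes t: "0 \<le> t"
    and w: "\<And>s. 0 \<le> s \<Longrightarrow> s \<le> t \<Longrightarrow> (w has_vector_derivative w' s) (at s)"
    and w': "\<And>s. 0 \<le> s \<Longrightarrow> s \<le> t \<Longrightarrow> norm (w' s) \<le> k * norm (w s) + c"
    and k: "0 \<le> k"
  shows "norm (w t) ^ 2 \<le> (norm (w 0) ^ 2 + c ^ 2) * exp ((2 * k + 1) * t)"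
proof -
  have "(\<lambda>s. w s \<bullet> w s) t \<le> ((\<lambda>s. w s \<bullet> w s) 0 + c ^ 2) * exp ((2 * k + 1) * t)"
  proof (rule gronwall_affine[OF t])
    fix s assume s: "0 \<le> s" "s \<le> t"
    show "((\<lambda>s. w s \<bullet> w s) has_real_derivative 2 * (w s \<bullet> w' s)) (at s)"
      using has_derivative_inner[OF w[OF s, unfolded has_vector_derivative_def]
          w[OF s, unfolded has_vector_derivative_def]]
      by (simp add: has_field_derivative_def inner_commute algebra_simps mult_commute_abs)
    have "w s \<bullet> w' s \<le> norm (w s) * norm (w' s)" by (rule norm_cauchy_schwarz)
    also have "\<dots> \<le> norm (w s) * (k * norm (w s) + c)"
      using w'[OF s] by (intro mult_left_mono) auto
    finally have "2 * (w s \<bullet> w' s) \<le> 2 * k * norm (w s) ^ 2 + 2 * norm (w s) * c"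
      by (simp add: power2_eq_square algebra_simps)
    moreover have "2 * norm (w s) * c \<le> norm (w s) ^ 2 + c ^ 2"
      using sum_squares_bound by blast
    ultimately show "2 * (w s \<bullet> w' s) \<le> (2 * k + 1) * (w s \<bullet> w s) + c ^ 2"
      by (simp add: power2_norm_eq_inner algebra_simps)
  qed (use k in auto)
  then show ?thesis by (simp add: power2_norm_eq_inner)
qed

lemma has_vector_derivative_reflect:
  assumes "(w has_vector_derivative w') (at (- s))"
  shows "((\<lambda>s. w (- s)) has_vector_derivative - w') (at s)"
proof -
  have "((w \<circ> uminus) has_vector_derivative (-1) *\<^sub>R w') (at s)"
    by (rule vector_diff_chain_at) (use assms in \<open>auto intro!: derivative_eq_intros\<close>)
  then show ?thesis by (simp add: o_def)
qed

lemma gronwall_norm: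
  fixes w :: "real \<Rightarrow> 'a::real_inner"
  assumes w: "\<And>s. \<bar>s\<bar> \<le> \<bar>t\<bar> \<Longrightarrow> (w has_vector_derivative w' s) (at s)"
    and w': "\<And>s. \<bar>s\<bar> \<le> \<bar>t\<bar> \<Longrightarrow> norm (w' s) \<le> k * norm (w s) + c"
    and k: "0 \<le> k"
  shows "norm (w t) ^ 2 \<le> (norm (w 0) ^ 2 + c ^ 2) * exp ((2 * k + 1) * \<bar>t\<bar>)"
proof (cases "0 \<le> t")
  case True
  then show ?thesis using gronwall_norm_forward[of t w w' k c] w w' k by auto
next
  case False
  then have "norm (w (- (- t))) ^ 2 \<le> (norm (w (- 0)) ^ 2 + c ^ 2) * exp ((2 * k + 1) * (- t))"
    by (intro gronwall_norm_forward[where w = "\<lambda>s. w (- s)" and w' = "\<lambda>s. - w' (- s)"]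
        has_vector_derivative_reflect) (use w w' k in auto)
  then show ?thesis using False by simp
qed

lemma antiderivative_exists:
  fixes g :: "real \<Rightarrow> 'a::euclidean_space"
  assumes "continuous_on UNIV g"
  obtains G where "G 0 = 0" "\<And>t. (G has_vector_derivative g t) (at t)"
proof -
  have "\<exists>F. \<forall>x::real. -\<infinity> < ereal x \<longrightarrow> ereal x < \<infinity> \<longrightarrow> (F has_vector_derivative g x) (at x)"
    by (rule einterval_antiderivative) (use assms continuous_on_eq_continuous_at in auto)
  then obtain F where "\<And>t. (F has_vector_derivative g t) (at t)" by auto
  then have "((\<lambda>t. F t - F 0) has_vector_derivative g t) (at t)" for t
    by (auto intro!: derivative_eq_intros)
  then show ?thesis using that[of "\<lambda>t. F t - F 0"] by simp
qed

text \<open>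
  Integration gains the factor \<open>1 / k\<close> against the weight \<open>exp(k t)\<close>. With \<open>k\<close> twice the Lipschitz
  constant this makes the Picard operator a contraction with factor \<open>1 / 2\<close>.
\<close>

lemma antiderivative_exp_bound_forward:
  fixes G :: "real \<Rightarrow> 'a::euclidean_space"
  assumes G: "G 0 = 0" "\<And>t. (G has_vector_derivative g t) (at t)"
    and g: "\<And>s. 0 \<le> s \<Longrightarrow> norm (g s) \<le> a * exp (k * s)" and k: "0 < k" "0 \<le> a" and t: "0 \<le> t"
  shows "norm (G t) \<le> a / k * exp (k * t)"
proof (cases "t = 0")
  case False
  with t have t: "0 < t" by simp
  have "norm (G t - G 0) \<le> a / k * exp (k * t) - a / k * exp (k * 0)"
  proof (rule differentiable_bound_general[OF t, where f' = g and \<phi>' = "\<lambda>s. a * exp (k * s)"])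
    show "continuous_on {0..t} G"
      using G(2) by (meson continuous_at_imp_continuous_on has_vector_derivative_continuous)
    show "((\<lambda>s. a / k * exp (k * s)) has_vector_derivative a * exp (k * x)) (at x)" for x
      using k by (auto intro!: derivative_eq_intros
          simp: has_real_derivative_iff_has_vector_derivative[symmetric])
  qed (use G g k in \<open>auto intro!: continuous_intros\<close>)
  then show ?thesis using G k by (simp add: field_simps)
qed (use G k in simp)

lemma antiderivative_exp_bound:
  fixes G :: "real \<Rightarrow> 'a::euclidean_space"
  assumes G: "G 0 = 0" "\<And>t. (G has_vector_derivative g t) (at t)"
    and g: "\<And>s. norm (g s) \<le> a * exp (k * \<bar>s\<bar>)" and k: "0 < k" "0 \<le> a"
  shows "norm (G t) \<le> a / k * exp (k * \<bar>t\<bar>)"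
proof (cases "0 \<le> t")
  case True
  have "norm (g s) \<le> a * exp (k * s)" if "0 \<le> s" for s using g[of s] that by simp
  from antiderivative_exp_bound_forward[OF G this k True] show ?thesis using True by simp
next
  case False
  have *: "norm (- g (- s)) \<le> a * exp (k * s)" if "0 \<le> s" for s using g[of "- s"] that by simp
  have "norm (G (- (- t))) \<le> a / k * exp (k * (- t))"
    by (rule antiderivative_exp_bound_forward[OF _ has_vector_derivative_reflect[OF G(2)] * k])
      (use G False in auto)
  then show ?thesis using False by simp
qed

text \<open>
  Picard's operator \<open>x \<mapsto> x\<^sub>0 + \<integral>\<^sub>0\<^sup>t f s (x s) ds\<close> is considered on functions of the form \<open>x = w y\<close> with
  \<open>w t = exp(2 K \<bar>t\<bar>)\<close> and \<open>y\<close> bounded and continuous. In the supremum norm of \<open>y\<close> it is a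
  contraction on the whole real line, so that no local solutions have to be glued together.
\<close>

lemma global_solution_exists:
  fixes f :: "real \<Rightarrow> 'a \<Rightarrow> 'a::euclidean_space"
  assumes cont: "continuous_on UNIV (\<lambda>(t, x). f t x)"
    and lip: "\<And>t x y. norm (f t x - f t y) \<le> K * norm (x - y)" and K: "0 < K"
    and bnd: "\<And>t. norm (f t 0) \<le> B"
  obtains x where "x 0 = x0" "\<And>t. (x has_vector_derivative f t (x t)) (at t)"
proof -
  define w where "w t = exp (2 * K * \<bar>t\<bar>)" for t :: real
  have w: "w t \<ge> 1" "w t > 0" "w t \<noteq> 0" for t using K by (auto simp: w_def)
  have contw: "continuous_on UNIV w" unfolding w_def by (intro continuous_intros)
  have B: "0 \<le> B" using bnd[of 0] norm_ge_zero order_trans by blast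
  define g where "g y s = f s (w s *\<^sub>R apply_bcontfun y s)" for y s
  have contg: "continuous_on UNIV (g y)" for y
  proof -
    have "continuous_on UNIV ((\<lambda>(t, x). f t x) \<circ> (\<lambda>s. (s, w s *\<^sub>R apply_bcontfun y s)))"
      by (intro continuous_on_compose continuous_on_subset[OF cont] continuous_intros contw) auto
    then show ?thesis by (simp add: o_def g_def[abs_def])
  qed
  then have "\<forall>y. \<exists>G. G 0 = 0 \<and> (\<forall>t. (G has_vector_derivative g y t) (at t))"
    by (metis antiderivative_exists)
  then obtain G where G: "\<And>y. G y 0 = 0" "\<And>y t. (G y has_vector_derivative g y t) (at t)"
    by metis
  have contG: "continuous_on UNIV (G y)" for y
    using G(2) by (meson continuous_at_imp_continuous_on has_vector_derivative_continuous)
  have Gbound: "norm (G y t) \<le> (B + K * norm y) / (2 * K) * w t" for y t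
    unfolding w_def
  proof (rule antiderivative_exp_bound[OF G])
    fix s
    have "norm (g y s) \<le> norm (f s 0) + norm (g y s - f s 0)" by norm
    also have "\<dots> \<le> B + K * norm (w s *\<^sub>R apply_bcontfun y s - 0)"
      unfolding g_def by (intro add_mono bnd lip)
    also have "\<dots> = B + K * (w s * norm (apply_bcontfun y s))" using w by (simp add: abs_of_pos)
    also have "\<dots> \<le> B * w s + K * (w s * norm y)"
      using B K w[of s] mult_left_mono[of 1 "w s" B] by (intro add_mono mult_left_mono norm_bounded) auto
    finally show "norm (g y s) \<le> (B + K * norm y) * exp (2 * K * \<bar>s\<bar>)"
      by (simp add: w_def algebra_simps)
  qed (use K B in auto)
  have Gdiff: "norm (G y t - G z t) \<le> (K * dist y z) / (2 * K) * w t" for y z t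
    unfolding w_def
  proof (rule antiderivative_exp_bound[where G = "\<lambda>t. G y t - G z t" and g = "\<lambda>t. g y t - g z t"])
    fix s
    have "norm (g y s - g z s) \<le> K * norm (w s *\<^sub>R apply_bcontfun y s - w s *\<^sub>R apply_bcontfun z s)"
      unfolding g_def by (rule lip)
    also have "\<dots> = K * (w s * dist (apply_bcontfun y s) (apply_bcontfun z s))"
      using w by (simp add: dist_norm abs_of_pos flip: scaleR_right_diff_distrib)
    also have "\<dots> \<le> K * (w s * dist y z)"
      using K w[of s] by (intro mult_left_mono dist_bounded) auto
    finally show "norm (g y s - g z s) \<le> K * dist y z * exp (2 * K * \<bar>s\<bar>)"
      by (simp add: w_def algebra_simps)
  qed (use K G in \<open>auto intro!: derivative_eq_intros\<close>)
  \<comment> \<open>Picard's operator in terms of \<open>y = x / w\<close>; \<open>G y\<close> is the antiderivative of \<open>f s (x s)\<close>.\<close>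
  define Q where "Q y t = (1 / w t) *\<^sub>R (x0 + G y t)" for y t
  have Q: "Q y \<in> bcontfun" for y
  proof (rule bcontfun_normI)
    show "continuous_on UNIV (Q y)"
      unfolding Q_def using w by (intro continuous_intros contw contG) auto
    fix t
    have "norm (Q y t) = norm (x0 + G y t) / w t" using w by (simp add: Q_def abs_of_pos)
    also have "\<dots> \<le> (norm x0 * w t + (B + K * norm y) / (2 * K) * w t) / w t"
      using w[of t] mult_left_mono[of 1 "w t" "norm x0"]
      by (intro divide_right_mono order_trans[OF norm_triangle_ineq] add_mono Gbound) auto
    also have "\<dots> = norm x0 + (B + K * norm y) / (2 * K)" using w by (simp add: add_divide_distrib)
    finally show "norm (Q y t) \<le> norm x0 + (B + K * norm y) / (2 * K)" .
  qed
  have "\<exists>!y. Bcontfun (Q y) = y"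
  proof (rule banach_fix_type[of "1/2"], safe)
    fix y z
    have "dist (Bcontfun (Q y)) (Bcontfun (Q z)) \<le> 1 / 2 * dist y z"
    proof (rule dist_bound)
      fix t
      have "dist (Q y t) (Q z t) = norm (G y t - G z t) / w t"
        using w by (simp add: Q_def dist_norm abs_of_pos flip: scaleR_right_diff_distrib)
      also have "\<dots> \<le> ((K * dist y z) / (2 * K) * w t) / w t"
        using w[of t] by (intro divide_right_mono Gdiff) auto
      also have "\<dots> = 1 / 2 * dist y z" using w[of t] K by simp
      finally show "dist (Bcontfun (Q y) t) (Bcontfun (Q z) t) \<le> 1 / 2 * dist y z"
        using Q by (simp add: Bcontfun_inverse)
    qed
    then show "dist (Bcontfun (Q y)) (Bcontfun (Q z)) \<le> 1 / 2 * dist y z" .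
  qed auto
  then obtain y where "Bcontfun (Q y) = y" by blast
  then have y: "apply_bcontfun y t = Q y t" for t using Q by (metis Bcontfun_inverse)
  define x where "x t = x0 + G y t" for t
  have "x t = w t *\<^sub>R apply_bcontfun y t" for t using w[of t] by (simp add: y x_def Q_def)
  then have "g y t = f t (x t)" for t by (simp add: g_def)
  then have "(x has_vector_derivative f t (x t)) (at t)" for t
    using G(2)[of y t] unfolding x_def by (auto intro!: derivative_eq_intros)
  moreover have "x 0 = x0" by (simp add: x_def G)
  ultimately show ?thesis using that by blast
qed

section \<open>Flows of Lipschitz fields and their Jacobian matrices\<close>

lemma has_vector_derivative_time_shift:
  assumes "\<And>t. (u has_vector_derivative u' t) (at t)"
  shows "((\<lambda>s. u (s + c)) has_vector_derivative u' (t + c)) (at t)"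
proof -
  have "((u \<circ> (\<lambda>s. s + c)) has_vector_derivative 1 *\<^sub>R u' (t + c)) (at t)"
    by (rule vector_diff_chain_at) (use assms in \<open>auto intro!: derivative_eq_intros\<close>)
  then show ?thesis by (simp add: o_def)
qed

text \<open>
  What the flow construction uses of a compactly supported smooth field: it is Lipschitz with a
  bounded Lipschitz derivative. One constant for all bounds keeps the estimates short.
\<close>

locale C11_field =
  fixes \<xi> :: "real^'n \<Rightarrow> real^'n" and \<xi>' :: "real^'n \<Rightarrow> real^'n \<Rightarrow> real^'n" and K :: real
  assumes K_pos: "0 < K"
    and field_has_derivative: "\<And>x. (\<xi> has_derivative \<xi>' x) (at x)"
    and field_lipschitz: "\<And>x y. norm (\<xi> x - \<xi> y) \<le> K * norm (x - y)"
    and deriv_bound: "\<And>x h. norm (\<xi>' x h) \<le> K * norm h"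
    and deriv_lipschitz: "\<And>x y h. norm (\<xi>' x h - \<xi>' y h) \<le> K * norm (x - y) * norm h"
begin

text \<open>
  The factor by which \<open>gronwall_norm\<close> bounds the separation of solutions after time \<open>t\<close>. That
  lemma bounds the squared norm; being at least 1, the factor also bounds its own square root.
\<close>

definition growth :: "real \<Rightarrow> real"
  where "growth t = exp ((2 * K + 1) * \<bar>t\<bar>)"

lemma growth_ge_1: "1 \<le> growth t"
  using K_pos by (simp add: growth_def)

lemma growth_mono: "\<bar>s\<bar> \<le> \<bar>t\<bar> \<Longrightarrow> growth s \<le> growth t"
  using K_pos by (simp add: growth_def)

lemma linear_deriv: "linear (\<xi>' x)"
  using field_has_derivative has_derivative_linear by blast

lemma norm_le_of_gronwall:
  assumes "norm a ^ 2 \<le> c ^ 2 * growth t" "0 \<le> c"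
  shows "norm a \<le> c * growth t"
proof (rule power2_le_imp_le)
  have "c ^ 2 * growth t \<le> c ^ 2 * (growth t * growth t)"
    using growth_ge_1[of t] by (intro mult_left_mono) auto
  then show "norm a ^ 2 \<le> (c * growth t) ^ 2"
    using assms by (simp add: power2_eq_square algebra_simps)
  show "0 \<le> c * growth t" using assms growth_ge_1[of t] by simp
qed

lemma integral_curves_dist:
  assumes u: "\<And>t. (u has_vector_derivative \<xi> (u t)) (at t)"
    and v: "\<And>t. (v has_vector_derivative \<xi> (v t)) (at t)"
  shows "norm (u t - v t) \<le> norm (u 0 - v 0) * growth t"
proof (rule norm_le_of_gronwall)
  have "norm (u t - v t) ^ 2 \<le> (norm (u 0 - v 0) ^ 2 + 0 ^ 2) * exp ((2 * K + 1) * \<bar>t\<bar>)"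
    by (rule gronwall_norm[where w = "\<lambda>t. u t - v t" and w' = "\<lambda>t. \<xi> (u t) - \<xi> (v t)"])
      (use K_pos field_lipschitz in \<open>auto intro!: derivative_eq_intros u v\<close>)
  then show "norm (u t - v t) ^ 2 \<le> norm (u 0 - v 0) ^ 2 * growth t" by (simp add: growth_def)
qed simp

lemma integral_curve_unique:
  assumes u: "\<And>t. (u has_vector_derivative \<xi> (u t)) (at t)"
    and v: "\<And>t. (v has_vector_derivative \<xi> (v t)) (at t)"
    and eq: "u t0 = v t0"
  shows "u t = v t"
  using integral_curves_dist[OF has_vector_derivative_time_shift[OF u, of t0]
      has_vector_derivative_time_shift[OF v, of t0], of "t - t0"] eq
  by simp

text \<open>
  The map \<open>x \<mapsto> \<xi> x - \<xi>' a x\<close> has a derivative of norm at most \<open>K norm (b - a)\<close> on the segment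
  from \<open>a\<close> to \<open>b\<close>.
\<close>

lemma field_taylor_bound: "norm (\<xi> b - \<xi> a - \<xi>' a (b - a)) \<le> K * norm (b - a) ^ 2"
proof -
  interpret D: linear "\<xi>' a" by (rule linear_deriv)
  have "norm ((\<xi> b - \<xi>' a b) - (\<xi> a - \<xi>' a a)) \<le> (K * norm (b - a)) * norm (b - a)"
  proof (rule differentiable_bound[of "closed_segment a b" "\<lambda>x. \<xi> x - \<xi>' a x" "\<lambda>x h. \<xi>' x h - \<xi>' a h"])
    fix x assume "x \<in> closed_segment a b"
    then have "norm (x - a) \<le> norm (b - a)" using segment_bound by blast
    then show "onorm (\<lambda>h. \<xi>' x h - \<xi>' a h) \<le> K * norm (b - a)"
      using K_pos by (intro onorm_le order_trans[OF deriv_lipschitz] mult_right_mono) auto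
    show "((\<lambda>x. \<xi> x - \<xi>' a x) has_derivative (\<lambda>h. \<xi>' x h - \<xi>' a h)) (at x within closed_segment a b)"
      by (intro has_derivative_diff has_derivative_at_withinI[OF field_has_derivative]
          linear_imp_has_derivative linear_deriv)
  qed auto
  then show ?thesis by (simp add: D.diff power2_eq_square algebra_simps)
qed

text \<open>
  The variational equation is linear in \<open>v\<close>, so it is globally Lipschitz and vanishes at \<open>v = 0\<close>;
  only joint continuity in time and \<open>v\<close> needs an argument.
\<close>

lemma variational_solution_exists:
  assumes u: "continuous_on UNIV u"
  obtains v where "v 0 = h" "\<And>t. (v has_vector_derivative \<xi>' (u t) (v t)) (at t)"
proof (rule global_solution_exists[of "\<lambda>t. \<xi>' (u t)" K 0])
  have cont: "continuous_on UNIV (\<lambda>x. \<xi>' x b)" for b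
  proof (rule lipschitz_on_continuous_on[of "K * norm b"], rule lipschitz_onI)
    show "dist (\<xi>' x b) (\<xi>' y b) \<le> K * norm b * dist x y" for x y
      using deriv_lipschitz[of x b y] by (simp add: dist_norm algebra_simps)
  qed (use K_pos in simp)
  have "continuous_on UNIV (\<lambda>p::real \<times> (real^'n). u (fst p))"
    by (rule continuous_on_compose2[OF u continuous_on_fst]) (auto intro: continuous_on_id)
  then have "continuous_on UNIV (\<lambda>p::real \<times> (real^'n). \<xi>' (u (fst p)) b)" for b
    by (rule continuous_on_compose2[OF cont]) auto
  then have "continuous_on UNIV (\<lambda>p::real \<times> (real^'n).
      \<Sum>b\<in>Basis. (snd p \<bullet> b) *\<^sub>R \<xi>' (u (fst p)) b)"
    by (intro continuous_on_sum continuous_on_scaleR continuous_on_inner continuous_on_const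
        continuous_on_snd continuous_on_id)
  moreover
  have expand: "\<xi>' a x = (\<Sum>b\<in>Basis. (x \<bullet> b) *\<^sub>R \<xi>' a b)" for a x
    using linear_sum[OF linear_deriv, of a "\<lambda>b. (x \<bullet> b) *\<^sub>R b" Basis]
      linear_scale[OF linear_deriv] by (simp add: euclidean_representation)
  have "(\<lambda>(t, x). \<xi>' (u t) x) = (\<lambda>p. \<Sum>b\<in>Basis. (snd p \<bullet> b) *\<^sub>R \<xi>' (u (fst p)) b)"
  proof
    fix p show "(\<lambda>(t, x). \<xi>' (u t) x) p = (\<Sum>b\<in>Basis. (snd p \<bullet> b) *\<^sub>R \<xi>' (u (fst p)) b)"
      using expand[of "u (fst p)" "snd p"] by (simp add: case_prod_beta)
  qed
  ultimately show "continuous_on UNIV (\<lambda>(t, x). \<xi>' (u t) x)" by simp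
  interpret D: linear "\<xi>' a" for a by (rule linear_deriv)
  show "norm (\<xi>' (u t) x - \<xi>' (u t) y) \<le> K * norm (x - y)" for t x y
    using deriv_bound[of "u t" "x - y"] by (simp add: D.diff)
  show "norm (\<xi>' (u t) 0) \<le> 0" for t by (simp add: D.zero)
  show thesis if "x 0 = h" "\<And>t. (x has_vector_derivative \<xi>' (u t) (x t)) (at t)" for x
    using that \<open>\<And>v. v 0 = h \<Longrightarrow> (\<And>t. (v has_vector_derivative \<xi>' (u t) (v t)) (at t)) \<Longrightarrow> thesis\<close>
    by blast
qed (rule K_pos)

text \<open>
  A combination of solutions solves the same equation, and by Gronwall a solution that vanishes at
  time 0 vanishes identically. Hence the solution depends linearly on its initial value.
\<close>

lemma linear_variational_solution:
  assumes u: "\<And>h. v 0 h = h" "\<And>h t. ((\<lambda>t. v t h) has_vector_derivative \<xi>' (u t) (v t h)) (at t)"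
  shows "linear (v t)" "norm (v t h) \<le> norm h * growth t"
proof -
  interpret D: linear "\<xi>' a" for a by (rule linear_deriv)
  have bound: "norm (w t) \<le> norm (w 0) * growth t"
    if w: "\<And>t. (w has_vector_derivative \<xi>' (u t) (w t)) (at t)" for w
  proof (rule norm_le_of_gronwall)
    have "norm (w t) ^ 2 \<le> (norm (w 0) ^ 2 + 0 ^ 2) * exp ((2 * K + 1) * \<bar>t\<bar>)"
      by (rule gronwall_norm[OF w]) (use K_pos deriv_bound in auto)
    then show "norm (w t) ^ 2 \<le> norm (w 0) ^ 2 * growth t" by (simp add: growth_def)
  qed simp
  show "norm (v t h) \<le> norm h * growth t" using bound[of "\<lambda>t. v t h"] u by simp
  show "linear (v t)"
  proof (rule linearI)
    fix x y and c :: real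
    have "norm (v t (x + y) - (v t x + v t y)) \<le> norm (v 0 (x + y) - (v 0 x + v 0 y)) * growth t"
      by (rule bound) (auto intro!: derivative_eq_intros u(2) simp: D.add D.diff)
    then show "v t (x + y) = v t x + v t y" by (simp add: u(1))
    have "norm (v t (c *\<^sub>R x) - c *\<^sub>R v t x) \<le> norm (v 0 (c *\<^sub>R x) - c *\<^sub>R v 0 x) * growth t"
      by (rule bound) (auto intro!: derivative_eq_intros u(2) simp: D.scale D.diff)
    then show "v t (c *\<^sub>R x) = c *\<^sub>R v t x" by (simp add: u(1))
  qed
qed

text \<open>
  A trajectory starting in \<open>D\<close> cannot leave it: at a point outside \<open>D\<close> the field vanishes, so the
  constant curve would be a second trajectory through that point.
\<close>

lemma flow_exists:
  assumes zero: "\<And>x. x \<notin> D \<Longrightarrow> \<xi> x = 0"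
  obtains \<phi> where "is_flow_of \<phi> \<xi> D"
proof -
  have "continuous_on UNIV \<xi>"
    using field_has_derivative by (meson continuous_at_imp_continuous_on has_derivative_continuous)
  then have "continuous_on UNIV (\<lambda>p::real \<times> (real^'n). \<xi> (snd p))"
    by (rule continuous_on_compose2) (auto intro: continuous_intros)
  then have "\<exists>x. x 0 = y \<and> (\<forall>t. (x has_vector_derivative \<xi> (x t)) (at t))" for y
    using global_solution_exists[of "\<lambda>t. \<xi>" K "norm (\<xi> 0)" y] K_pos field_lipschitz
    by (simp add: case_prod_beta) metis
  then obtain x where x: "\<And>y. x y 0 = y" "\<And>y t. (x y has_vector_derivative \<xi> (x y t)) (at t)"
    by metis
  have "x y t \<in> D" if "y \<in> D" for y t
  proof (rule ccontr)
    assume notin: "x y t \<notin> D"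
    have "((\<lambda>_. x y t) has_vector_derivative \<xi> (x y t)) (at s)" for s
      using zero[OF notin] by simp
    from integral_curve_unique[OF x(2) this, of y t 0] have "y = x y t" by (simp add: x)
    with notin that show False by simp
  qed
  then have "is_flow_of (\<lambda>t y. x y t) \<xi> D" using x by (simp add: is_flow_of_def)
  then show ?thesis using that by blast
qed

context
  fixes \<phi> D
  assumes flow: "is_flow_of \<phi> \<xi> D"
begin

lemma flow_0: "y \<in> D \<Longrightarrow> \<phi> 0 y = y"
  and flow_in: "y \<in> D \<Longrightarrow> \<phi> t y \<in> D"
  and flow_deriv: "y \<in> D \<Longrightarrow> ((\<lambda>t. \<phi> t y) has_vector_derivative \<xi> (\<phi> t y)) (at t)"
  using flow by (auto simp: is_flow_of_def)

text \<open>
  Both sides, as functions of \<open>s\<close>, are integral curves of \<open>\<xi>\<close> that agree at \<open>s = 0\<close>.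
\<close>

lemma flow_group:
  assumes y: "y \<in> D"
  shows "\<phi> s (\<phi> t y) = \<phi> (s + t) y"
  by (rule integral_curve_unique[where u = "\<lambda>s. \<phi> s (\<phi> t y)" and v = "\<lambda>s. \<phi> (s + t) y" and ?t0.0 = 0])
    (auto intro: flow_deriv flow_in y has_vector_derivative_time_shift[OF flow_deriv] simp: flow_0 flow_in y)

lemma flow_inverse:
  assumes y: "y \<in> D"
  shows "\<phi> (- t) (\<phi> t y) = y" "\<phi> t (\<phi> (- t) y) = y"
  using flow_group[OF y, of "- t" t] flow_group[OF y, of t "- t"] flow_0[OF y] by simp_all

text \<open>
  The error \<open>w\<close> solves \<open>w' = \<xi>' a w + r\<close>, where \<open>a = \<phi> s y\<close> and \<open>r\<close> is the Taylor remainder of \<open>\<xi>\<close>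
  between \<open>a\<close> and \<open>\<phi> s (y + h)\<close>. Trajectories separate at most by the factor \<open>growth\<close>, so \<open>r\<close> is
  quadratic in \<open>h\<close>, and Gronwall transfers this to \<open>w\<close>.
\<close>

lemma flow_linearization_error:
  assumes y: "y \<in> D" "y + h \<in> D"
    and v: "v 0 = h" "\<And>t. (v has_vector_derivative \<xi>' (\<phi> t y) (v t)) (at t)"
  shows "norm (\<phi> t (y + h) - \<phi> t y - v t) \<le> (K * growth t ^ 3) * norm h ^ 2"
proof -
  interpret D: linear "\<xi>' a" for a by (rule linear_deriv)
  define w where "w t = \<phi> t (y + h) - \<phi> t y - v t" for t
  define w' where "w' t = \<xi> (\<phi> t (y + h)) - \<xi> (\<phi> t y) - \<xi>' (\<phi> t y) (v t)" for t
  define c where "c = K * (norm h * growth t) ^ 2"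
  have "norm (w t) ^ 2 \<le> (norm (w 0) ^ 2 + c ^ 2) * exp ((2 * K + 1) * \<bar>t\<bar>)"
  proof (rule gronwall_norm)
    show "(w has_vector_derivative w' s) (at s)" for s
      unfolding w_def w'_def by (auto intro!: derivative_eq_intros flow_deriv y v)
    fix s assume s: "\<bar>s\<bar> \<le> \<bar>t\<bar>"
    define a where "a = \<phi> s y"
    define b where "b = \<phi> s (y + h)"
    have "norm (b - a) \<le> norm h * growth s"
      using integral_curves_dist[OF flow_deriv flow_deriv, OF y(2,1), of s] y
      by (simp add: a_def b_def flow_0)
    also have "\<dots> \<le> norm h * growth t" using growth_mono[OF s] by (simp add: mult_left_mono)
    finally have "norm (b - a) ^ 2 \<le> (norm h * growth t) ^ 2" by (intro power_mono) auto
    then have "norm (\<xi> b - \<xi> a - \<xi>' a (b - a)) \<le> c"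
      using field_taylor_bound[of b a] K_pos unfolding c_def
      by (meson dual_order.trans less_imp_le mult_left_mono)
    moreover have "w' s = \<xi>' a (w s) + (\<xi> b - \<xi> a - \<xi>' a (b - a))"
      by (simp add: w'_def w_def a_def b_def D.diff)
    then have "norm (w' s) \<le> norm (\<xi>' a (w s)) + norm (\<xi> b - \<xi> a - \<xi>' a (b - a))"
      by (metis norm_triangle_ineq)
    ultimately show "norm (w' s) \<le> K * norm (w s) + c"
      using deriv_bound[of a "w s"] by linarith
  qed (use K_pos in simp)
  then have "norm (w t) ^ 2 \<le> c ^ 2 * growth t" using y v by (simp add: w_def flow_0 growth_def)
  then have "norm (w t) \<le> c * growth t" by (rule norm_le_of_gronwall) (use K_pos in \<open>simp add: c_def\<close>)
  then show ?thesis by (simp add: w_def c_def power_mult_distrib power2_eq_square power3_eq_cube algebra_simps)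
qed

lemma flow_has_derivative:
  assumes D: "open D" and y: "y \<in> D"
    and v: "\<And>h. v 0 h = h" "\<And>h t. ((\<lambda>t. v t h) has_vector_derivative \<xi>' (\<phi> t y) (v t h)) (at t)"
  shows "(\<phi> t has_derivative v t) (at y)"
  unfolding has_derivative_at_alt
proof (intro conjI allI impI)
  show "bounded_linear (v t)"
    using linear_variational_solution(1)[of v, OF v] by (simp add: linear_conv_bounded_linear)
  fix e :: real assume e: "e > 0"
  obtain r where r: "r > 0" "ball y r \<subseteq> D" using D y openE by blast
  define C where "C = K * growth t ^ 3"
  have C: "C > 0" using K_pos growth_ge_1[of t] by (simp add: C_def)
  \<comment> \<open>Within \<open>r\<close> the point stays in \<open>D\<close>, where \<open>\<phi>\<close> is a flow; within \<open>e / C\<close> the quadratic error is below \<open>e norm (z - y)\<close>.\<close>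
  show "\<exists>d>0. \<forall>z. norm (z - y) < d \<longrightarrow> norm (\<phi> t z - \<phi> t y - v t (z - y)) \<le> e * norm (z - y)"
  proof (intro exI[of _ "min r (e / C)"] conjI allI impI)
    fix z assume z: "norm (z - y) < min r (e / C)"
    then have "z \<in> D" using r by (auto simp: dist_norm norm_minus_commute)
    then have "norm (\<phi> t (y + (z - y)) - \<phi> t y - v t (z - y)) \<le> C * norm (z - y) ^ 2"
      unfolding C_def using y by (intro flow_linearization_error[where v = "\<lambda>t. v t (z - y)"] v) auto
    also have "\<dots> = (C * norm (z - y)) * norm (z - y)" by (simp add: power2_eq_square)
    also have "\<dots> \<le> e * norm (z - y)" using z C by (intro mult_right_mono) (auto simp: field_simps)
    finally show "norm (\<phi> t z - \<phi> t y - v t (z - y)) \<le> e * norm (z - y)" by simp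
  qed (use r e C in auto)
qed

text \<open>
  The columns of the Jacobian matrix are the solutions of the variational equation that start at
  the unit vectors. This makes the entries differentiable in time, with derivatives given by \<open>\<xi>'\<close>.
\<close>

lemma flow_jacobian:
  assumes D: "open D" and y: "y \<in> D"
  shows "(\<phi> t has_derivative (\<lambda>h. jacobian (\<phi> t) (at y) *v h)) (at y)"
    and "norm (jacobian (\<phi> t) (at y) *v h) \<le> norm h * growth t"
    and "((\<lambda>t. jacobian (\<phi> t) (at y) $ a $ b) has_real_derivative
      \<xi>' (\<phi> t y) (jacobian (\<phi> t) (at y) *v axis b 1) $ a) (at t)"
    and "jacobian (\<phi> 0) (at y) = mat 1"
proof -
  have "continuous_on UNIV (\<lambda>t. \<phi> t y)"
    using flow_deriv[OF y] by (meson continuous_at_imp_continuous_on has_vector_derivative_continuous)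
  then have "\<exists>v. v 0 = h \<and> (\<forall>t. (v has_vector_derivative \<xi>' (\<phi> t y) (v t)) (at t))" for h
    using variational_solution_exists by metis
  then obtain v0 where v0: "\<And>h. v0 h 0 = h"
    "\<And>h t. (v0 h has_vector_derivative \<xi>' (\<phi> t y) (v0 h t)) (at t)" by metis
  define v where "v t h = v0 h t" for t h
  have v: "\<And>h. v 0 h = h" "\<And>h t. ((\<lambda>t. v t h) has_vector_derivative \<xi>' (\<phi> t y) (v t h)) (at t)"
    using v0 by (simp_all add: v_def)
  have der: "(\<phi> t has_derivative v t) (at y)" for t by (rule flow_has_derivative[OF D y v])
  then show J: "(\<phi> t has_derivative (\<lambda>h. jacobian (\<phi> t) (at y) *v h)) (at y)" for t
    using jacobian_works differentiable_def by blast
  have Jv: "jacobian (\<phi> t) (at y) *v h = v t h" for t h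
    using has_derivative_unique[OF J der] by metis
  show "norm (jacobian (\<phi> t) (at y) *v h) \<le> norm h * growth t"
    unfolding Jv by (rule linear_variational_solution(2)[OF v])
  have entry: "jacobian (\<phi> t) (at y) $ a $ b = v t (axis b 1) $ a" for t a b
    unfolding Jv[symmetric] by (simp add: matrix_vector_mult_basis column_def)
  show "((\<lambda>t. jacobian (\<phi> t) (at y) $ a $ b) has_real_derivative
      \<xi>' (\<phi> t y) (jacobian (\<phi> t) (at y) *v axis b 1) $ a) (at t)"
    unfolding entry Jv has_real_derivative_iff_has_vector_derivative
    by (rule bounded_linear.has_vector_derivative[OF bounded_linear_vec_nth v(2)])
  show "jacobian (\<phi> 0) (at y) = mat 1"
    unfolding matrix_eq by (simp add: Jv v)
qed

lemma flow_jacobian_inverse: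
  assumes D: "open D" and y: "y \<in> D"
  shows "jacobian (\<phi> (- t)) (at (\<phi> t y)) ** jacobian (\<phi> t) (at y) = mat 1"
proof -
  let ?J = "jacobian (\<phi> (- t)) (at (\<phi> t y))" and ?M = "jacobian (\<phi> t) (at y)"
  have "((\<lambda>z. \<phi> (- t) (\<phi> t z)) has_derivative (\<lambda>h. ?J *v (?M *v h))) (at y)"
    by (rule has_derivative_compose[OF flow_jacobian(1)[OF D y] flow_jacobian(1)[OF D flow_in[OF y]]])
  then have "((\<lambda>z. z) has_derivative (\<lambda>h. ?J *v (?M *v h))) (at y)"
    by (rule has_derivative_transform_within_open[OF _ D y]) (rule flow_inverse)
  from has_derivative_unique[OF this has_derivative_ident] have "?J *v (?M *v h) = h" for h
    by metis
  then show ?thesis by (simp add: matrix_eq matrix_vector_mul_assoc)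
qed

text \<open>
  The determinant is continuous in \<open>t\<close>, never zero because the Jacobian matrix is invertible, and
  equal to 1 at \<open>t = 0\<close>.
\<close>

lemma flow_jacobian_det_pos:
  assumes D: "open D" and y: "y \<in> D"
  shows "det (jacobian (\<phi> t) (at y)) > 0"
proof (rule ccontr)
  let ?d = "\<lambda>t. det (jacobian (\<phi> t) (at y))"
  assume "\<not> 0 < ?d t"
  then have t: "?d t \<le> 0" by simp
  have "continuous_on UNIV (\<lambda>t. jacobian (\<phi> t) (at y) $ a $ b)" for a b
    using flow_jacobian(3)[OF D y] by (meson DERIV_isCont continuous_at_imp_continuous_on)
  then have "continuous_on UNIV ?d"
    unfolding det_def
    by (intro continuous_on_sum continuous_on_mult continuous_on_const continuous_on_prod)
  then have "is_interval (range ?d)"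
    using connected_continuous_image connected_UNIV is_interval_connected_1 by blast
  moreover have "?d 0 = 1" using flow_jacobian(4)[OF D y] by simp
  then have "0 \<le> ?d 0" by simp
  ultimately have "0 \<in> range ?d" using t mem_is_interval_1_I[of _ "?d t" "?d 0" 0] by blast
  then obtain s where "?d s = 0" by auto
  moreover have "det (jacobian (\<phi> (- s)) (at (\<phi> s y))) * ?d s = 1"
    using flow_jacobian_inverse[OF D y, of s] by (metis det_I det_mul)
  ultimately show False by simp
qed

end

end

section \<open>Flows of test fields and the change of variables\<close>

text \<open>
  The total derivative \<open>D\<xi>(x) h\<close>, written with the partial derivatives that occur in the
  distributional divergence.
\<close>

definition field_derivative :: "(real^'n \<Rightarrow> real^'n) \<Rightarrow> real^'n \<Rightarrow> real^'n \<Rightarrow> real^'n"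
  where "field_derivative \<xi> x h = (\<chi> i. \<Sum>j\<in>UNIV. h $ j * pdv (axis j 1) (\<lambda>y. \<xi> y $ i) x)"

lemma norm_vec_le_sum:
  fixes x :: "real^'n"
  assumes "\<And>i. \<bar>x $ i\<bar> \<le> c i"
  shows "norm x \<le> (\<Sum>i\<in>UNIV. c i)"
  using norm_le_l1_cart[of x] sum_mono[of UNIV "\<lambda>i. \<bar>x $ i\<bar>" c] assms by force

lemma test_field_is_C11_field:
  fixes \<xi> :: "real^'n \<Rightarrow> real^'n"
  assumes \<xi>: "\<xi> \<in> test_fields D"
  obtains K where "C11_field \<xi> (field_derivative \<xi>) K"
proof -
  have t: "(\<lambda>y. \<xi> y $ i) \<in> test_functions D" for i using \<xi> by (simp add: test_fields_def)
  have tp: "pdv (axis j 1) (\<lambda>y. \<xi> y $ i) \<in> test_functions D" for i j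
    by (rule pdv_test_function[OF t]) simp
  have "\<exists>K\<ge>0. \<forall>x y. \<bar>\<xi> x $ i - \<xi> y $ i\<bar> \<le> K * norm (x - y)" for i
    by (rule test_function_lipschitz[OF t[of i]]) blast
  then obtain K1 where K1: "\<And>i. 0 \<le> K1 i" "\<And>i x y. \<bar>\<xi> x $ i - \<xi> y $ i\<bar> \<le> K1 i * norm (x - y)"
    by metis
  have "\<exists>K\<ge>0. \<forall>x y. \<bar>pdv (axis j 1) (\<lambda>y. \<xi> y $ i) x - pdv (axis j 1) (\<lambda>y. \<xi> y $ i) y\<bar> \<le> K * norm (x - y)"
    for i j by (rule test_function_lipschitz[OF tp[of j i]]) blast
  then have "\<exists>K2. \<forall>i j. 0 \<le> K2 i j \<and>
      (\<forall>x y. \<bar>pdv (axis j 1) (\<lambda>y. \<xi> y $ i) x - pdv (axis j 1) (\<lambda>y. \<xi> y $ i) y\<bar> \<le> K2 i j * norm (x - y))"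
    by (intro choice allI) blast
  then obtain K2 where K2: "\<And>i j. 0 \<le> K2 i j"
    "\<And>i j x y. \<bar>pdv (axis j 1) (\<lambda>y. \<xi> y $ i) x - pdv (axis j 1) (\<lambda>y. \<xi> y $ i) y\<bar> \<le> K2 i j * norm (x - y)"
    by blast
  have "\<exists>B. \<forall>x. \<bar>pdv (axis j 1) (\<lambda>y. \<xi> y $ i) x\<bar> \<le> B" for i j
    by (rule test_function_bounded[OF tp[of j i]]) blast
  then have "\<exists>B. \<forall>i j x. \<bar>pdv (axis j 1) (\<lambda>y. \<xi> y $ i) x\<bar> \<le> B i j"
    by (intro choice allI)
  then obtain B where B: "\<And>i j x. \<bar>pdv (axis j 1) (\<lambda>y. \<xi> y $ i) x\<bar> \<le> B i j"
    by blast
  have B0: "0 \<le> B i j" for i j using B[of j i 0] abs_ge_zero order_trans by blast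
  define K where "K = 1 + (\<Sum>i\<in>UNIV. K1 i) + (\<Sum>i\<in>UNIV. \<Sum>j\<in>UNIV. B i j) + (\<Sum>i\<in>UNIV. \<Sum>j\<in>UNIV. K2 i j)"
  have nn: "0 \<le> (\<Sum>i\<in>UNIV. K1 i)" "0 \<le> (\<Sum>i\<in>UNIV. \<Sum>j\<in>UNIV. B i j)" "0 \<le> (\<Sum>i\<in>UNIV. \<Sum>j\<in>UNIV. K2 i j)"
    using K1(1) B0 K2(1) by (auto intro!: sum_nonneg)
  have "C11_field \<xi> (field_derivative \<xi>) K"
  proof
    show "0 < K" using nn by (simp add: K_def)
    show "(\<xi> has_derivative field_derivative \<xi> x) (at x)" for x
      by (rule iffD2[OF has_derivative_componentwise_within])
        (use test_function_has_derivative[OF t] in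
          \<open>auto simp: Basis_vec_def inner_axis field_derivative_def\<close>)
    show "norm (\<xi> x - \<xi> y) \<le> K * norm (x - y)" for x y
    proof -
      have "norm (\<xi> x - \<xi> y) \<le> (\<Sum>i\<in>UNIV. K1 i * norm (x - y))"
        by (intro norm_vec_le_sum) (use K1 in simp)
      also have "\<dots> \<le> K * norm (x - y)"
        unfolding sum_distrib_right[symmetric] using nn by (intro mult_right_mono) (auto simp: K_def)
      finally show ?thesis .
    qed
    show "norm (field_derivative \<xi> x h) \<le> K * norm h" for x h
    proof -
      have "norm (field_derivative \<xi> x h) \<le> (\<Sum>i\<in>UNIV. (\<Sum>j\<in>UNIV. B i j) * norm h)"
        by (intro norm_vec_le_sum) (use B in \<open>simp add: field_derivative_def sum_components_bound\<close>)
      also have "\<dots> \<le> K * norm h"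
        unfolding sum_distrib_right[symmetric] using nn by (intro mult_right_mono) (auto simp: K_def)
      finally show ?thesis .
    qed
    show "norm (field_derivative \<xi> x h - field_derivative \<xi> y h) \<le> K * norm (x - y) * norm h" for x y h
    proof -
      have "\<bar>\<Sum>j\<in>UNIV. h $ j * (pdv (axis j 1) (\<lambda>y. \<xi> y $ i) x - pdv (axis j 1) (\<lambda>y. \<xi> y $ i) y)\<bar>
          \<le> (\<Sum>j\<in>UNIV. K2 i j * norm (x - y)) * norm h" for i
        by (intro sum_components_bound K2)
      then have "norm (field_derivative \<xi> x h - field_derivative \<xi> y h)
          \<le> (\<Sum>i\<in>UNIV. (\<Sum>j\<in>UNIV. K2 i j * norm (x - y)) * norm h)"
        by (intro norm_vec_le_sum)
          (simp add: field_derivative_def right_diff_distrib sum_subtractf)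
      also have "\<dots> \<le> K * norm (x - y) * norm h"
        unfolding sum_distrib_right[symmetric] using nn by (intro mult_right_mono) (auto simp: K_def)
      finally show ?thesis .
    qed
  qed
  then show ?thesis using that by blast
qed

lemma test_field_eq_0:
  assumes "\<xi> \<in> test_fields D" "x \<notin> D"
  shows "\<xi> x = 0"
proof -
  have "\<xi> x $ i = 0" for i
  proof -
    have "(\<lambda>y. \<xi> y $ i) \<in> test_functions D" using assms by (simp add: test_fields_def)
    then show ?thesis using test_function_eq_0 assms(2) unfolding test_functions_def by blast
  qed
  then show ?thesis by (simp add: vec_eq_iff)
qed

text \<open>
  If one integrand is not integrable then neither is the other, and both integrals are 0 by
  convention.
\<close>

lemma set_lebesgue_integral_change_of_variables:
  fixes f :: "real^'n::{finite,wellorder} \<Rightarrow> real" and g :: "real^'n::_ \<Rightarrow> real^'n::_"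
  assumes S: "S \<in> sets lebesgue"
    and der: "\<And>x. x \<in> S \<Longrightarrow> (g has_derivative g' x) (at x within S)"
    and inj: "inj_on g S"
  shows "(LINT x:S|lebesgue. \<bar>det (matrix (g' x))\<bar> * f (g x)) = (LINT y:g ` S|lebesgue. f y)"
proof -
  let ?F = "\<lambda>x. \<bar>det (matrix (g' x))\<bar> * f (g x)"
  have "(\<lambda>x. \<bar>det (matrix (g' x))\<bar> *\<^sub>R vec (f (g x)) :: real^1) absolutely_integrable_on S \<and>
      integral S (\<lambda>x. \<bar>det (matrix (g' x))\<bar> *\<^sub>R vec (f (g x))) = (vec b :: real^1)
    \<longleftrightarrow> (\<lambda>x. vec (f x) :: real^1) absolutely_integrable_on (g ` S) \<and>
      integral (g ` S) (\<lambda>x. vec (f x)) = (vec b :: real^1)" for b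
    by (rule has_absolute_integral_change_of_variables[OF S der inj])
  then have *: "?F absolutely_integrable_on S \<and> integral S ?F = b
    \<longleftrightarrow> f absolutely_integrable_on (g ` S) \<and> integral (g ` S) f = b" for b
    by (auto simp: absolutely_integrable_on_1_iff integral_on_1_eq)
  show ?thesis
  proof (cases "f absolutely_integrable_on (g ` S)")
    case True
    moreover from this have "?F absolutely_integrable_on S" "integral S ?F = integral (g ` S) f"
      using * by blast+
    ultimately show ?thesis by (simp add: set_lebesgue_integral_eq_integral(2))
  next
    case False
    then have "\<not> ?F absolutely_integrable_on S" using * by blast
    with False show ?thesis
      unfolding set_integrable_def set_lebesgue_integral_def by (simp add: not_integrable_integral_eq)
  qed
qed

text \<open>
  The substitution is \<open>z = \<phi> (-\<epsilon>) y\<close>. Its Jacobian matrix at \<open>y\<close> is the inverse of that of \<open>\<phi> \<epsilon>\<close> at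
  \<open>z\<close>, and both have positive determinant, so the factor \<open>\<bar>det\<bar>\<close> becomes the denominator of
  \<open>transported_integrand\<close>.
\<close>

lemma functional_pullback_eq_transported_integral:
  fixes D :: "(real^'n::{finite,wellorder}) set"
  assumes \<xi>: "\<xi> \<in> test_fields D" and flow: "is_flow_of \<phi> \<xi> D" and D: "open D"
  shows "functional D L (pullback p (\<phi> \<epsilon>) A) = (LINT y:D|lebesgue. transported_integrand p L A \<phi> \<epsilon> y)"
proof -
  obtain K where "C11_field \<xi> (field_derivative \<xi>) K" using test_field_is_C11_field[OF \<xi>] .
  then interpret C11_field \<xi> "field_derivative \<xi>" K .
  note flow_facts = flow_in[OF flow] flow_inverse[OF flow]
  let ?f = "\<lambda>z. L (pullback p (\<phi> \<epsilon>) A z)"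
  let ?M = "\<lambda>y. jacobian (\<phi> (- \<epsilon>)) (at y)"
  have img: "\<phi> (- \<epsilon>) ` D = D"
  proof
    show "D \<subseteq> \<phi> (- \<epsilon>) ` D" using flow_facts by (metis image_eqI subsetI)
  qed (use flow_facts in auto)
  have inj: "inj_on (\<phi> (- \<epsilon>)) D" using flow_facts by (metis inj_onI)
  have "(LINT y:D|lebesgue. \<bar>det (matrix ((*v) (?M y)))\<bar> * ?f (\<phi> (- \<epsilon>) y))
      = (LINT z:\<phi> (- \<epsilon>) ` D|lebesgue. ?f z)"
    by (rule set_lebesgue_integral_change_of_variables[OF _ _ inj])
      (use D flow_jacobian(1)[OF flow D] in \<open>auto intro: has_derivative_at_withinI\<close>)
  moreover have "\<bar>det (matrix ((*v) (?M y)))\<bar> * ?f (\<phi> (- \<epsilon>) y) = transported_integrand p L A \<phi> \<epsilon> y"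
    if y: "y \<in> D" for y
  proof -
    have "det (jacobian (\<phi> \<epsilon>) (at (\<phi> (- \<epsilon>) y))) * det (?M y) = 1"
      using flow_jacobian_inverse[OF flow D y, of "- \<epsilon>"] by (metis det_I det_mul minus_minus)
    then have "det (?M y) = 1 / det (jacobian (\<phi> \<epsilon>) (at (\<phi> (- \<epsilon>) y)))"
      by (metis mult.commute mult_zero_left nonzero_eq_divide_eq zero_neq_one)
    then show ?thesis using flow_jacobian_det_pos[OF flow D y, of "- \<epsilon>"]
      by (simp add: transported_integrand_def matrix_of_matrix_vector_mul)
  qed
  ultimately show ?thesis
    unfolding functional_def img
    using D set_lebesgue_integral_cong[of D lebesgue
        "\<lambda>y. \<bar>det (matrix ((*v) (?M y)))\<bar> * ?f (\<phi> (- \<epsilon>) y)" "transported_integrand p L A \<phi> \<epsilon>"]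
    by (auto simp: borel_open)
qed

section \<open>Minors and determinants near the identity matrix\<close>

text \<open>
  The minor with rows \<open>I\<close> and columns \<open>J\<close>, both listed in increasing order. It is written as the
  Leibniz sum over permutations of positions, to match the coordinates of a wedge product.
\<close>

definition minor :: "nat \<Rightarrow> real^'n::{finite,wellorder}^'n::_ \<Rightarrow> 'n set \<Rightarrow> 'n set \<Rightarrow> real"
  where "minor p W I J = (\<Sum>\<pi> | \<pi> permutes {..<p}. of_int (sign \<pi>) *
    (\<Prod>k<p. W $ (sorted_list_of_set I ! k) $ (sorted_list_of_set J ! \<pi> k)))"

lemma wedge_rows_nth:
  "wedge p (\<lambda>k. W $ (sorted_list_of_set I ! k)) $ J = (if card J = p then minor p W I J else 0)"
  by (simp add: wedge_def minor_def)

text \<open>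
  The cycle that carries position \<open>a\<close> to position \<open>b\<close> and shifts the positions in between down by
  one. It is a product of \<open>b - a\<close> adjacent transpositions.
\<close>

lemma rotation_permutation_exists:
  fixes a b :: nat
  assumes "a \<le> b"
  obtains \<pi> where "\<pi> permutes {a..b}" "sign \<pi> = (-1) ^ (b - a)" "\<pi> a = b"
    "\<And>k. a < k \<Longrightarrow> k \<le> b \<Longrightarrow> \<pi> k = k - 1"
proof -
  have "\<exists>\<pi>. \<pi> permutes {a..b} \<and> sign \<pi> = (-1) ^ (b - a) \<and> \<pi> a = b \<and>
      (\<forall>k. a < k \<longrightarrow> k \<le> b \<longrightarrow> \<pi> k = k - 1)"
    using assms
  proof (induction b rule: dec_induct)
    case base
    show ?case by (intro exI[of _ id]) (auto simp: permutes_id sign_id)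
  next
    case (step b)
    then obtain \<pi> where \<pi>: "\<pi> permutes {a..b}" "sign \<pi> = (-1) ^ (b - a)" "\<pi> a = b"
      "\<And>k. a < k \<Longrightarrow> k \<le> b \<Longrightarrow> \<pi> k = k - 1" by blast
    have perm: "\<pi> permutes {a..Suc b}" using \<pi>(1) by (rule permutes_subset) auto
    have tr: "Transposition.transpose b (Suc b) permutes {a..Suc b}"
      using step by (intro permutes_swap_id) auto
    have fixed: "\<pi> (Suc b) = Suc b" using \<pi>(1) by (auto intro: permutes_not_in)
    show ?case
    proof (intro exI[of _ "Transposition.transpose b (Suc b) \<circ> \<pi>"] conjI allI impI)
      show "Transposition.transpose b (Suc b) \<circ> \<pi> permutes {a..Suc b}" by (rule permutes_compose[OF perm tr])
      have "sign (Transposition.transpose b (Suc b) \<circ> \<pi>) = - sign \<pi>"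
        using perm tr by (subst sign_compose) (auto simp: permutation_permutes sign_swap_id)
      then show "sign (Transposition.transpose b (Suc b) \<circ> \<pi>) = (-1) ^ (Suc b - a)"
        using \<pi>(2) step by (simp add: Suc_diff_le)
      show "(Transposition.transpose b (Suc b) \<circ> \<pi>) a = Suc b" using \<pi>(3) by simp
      fix k assume k: "a < k" "k \<le> Suc b"
      show "(Transposition.transpose b (Suc b) \<circ> \<pi>) k = k - 1"
      proof (cases "k = Suc b")
        case True then show ?thesis using fixed by simp
      next
        case False
        then have "\<pi> k = k - 1" "k - 1 < b" using \<pi>(4)[of k] k by auto
        then show ?thesis by (simp add: transpose_def)
      qed
    qed
  qed
  then show ?thesis using that by blast
qed

text \<open>
  Inserting \<open>i\<close> puts it at position \<open>a\<close>, the number of smaller elements, and shifts the later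
  elements up by one. Comparing this for \<open>insert i K\<close> and \<open>insert j K\<close> shows which permutation of
  positions aligns the two lists on \<open>K\<close>.
\<close>

lemma nth_sorted_list_of_set_insert:
  fixes K :: "'a::linorder set"
  assumes K: "finite K" "i \<notin> K" and a: "a = card {k\<in>K. k < i}"
  shows "sorted_list_of_set (insert i K) ! k =
    (if k < a then sorted_list_of_set K ! k else if k = a then i else sorted_list_of_set K ! (k - 1))"
proof -
  let ?l = "sorted_list_of_set {k\<in>K. k < i}" and ?r = "sorted_list_of_set {k\<in>K. i < k}"
  have fin: "finite {k\<in>K. k < i}" "finite {k\<in>K. i < k}" using K by auto
  have split: "k < i \<or> i < k" if "k \<in> K" for k using K that by (metis neq_iff)
  have sets: "set ?l \<union> set ?r = K" using split fin by auto
  have "set (sorted_list_of_set K) = set (?l @ ?r)" using sets K(1) by simp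
  then have eqK: "sorted_list_of_set K = ?l @ ?r"
    by (rule sorted_distinct_set_unique[rotated 4]) (use fin in \<open>auto simp: sorted_append\<close>)
  have "set (sorted_list_of_set (insert i K)) = insert i K"
    by (rule set_sorted_list_of_set) (use K(1) in simp)
  also have "\<dots> = insert i (set ?l \<union> set ?r)" by (rule arg_cong[OF sets[symmetric]])
  also have "\<dots> = set (?l @ i # ?r)" by simp
  finally have eqi: "sorted_list_of_set (insert i K) = ?l @ i # ?r"
    by (rule sorted_distinct_set_unique[rotated 4]) (use fin in \<open>auto simp: sorted_append\<close>)
  show ?thesis
  proof (cases "k \<le> a")
    case True
    then show ?thesis unfolding eqK eqi by (auto simp: nth_append a[symmetric])
  next
    case False
    then have "k - a = Suc (k - 1 - a)" by simp
    with False show ?thesis unfolding eqK eqi by (simp add: nth_append a[symmetric])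
  qed
qed

lemma card_less_le_card: "finite K \<Longrightarrow> card {k\<in>K. k < i} \<le> card K"
  by (intro card_mono) auto

lemma between_count_commute: "between_count i j K = between_count j i K"
  by (simp add: between_count_def disj_commute)

text \<open>
  The exponent \<open>q(i,j;K)\<close> is the distance between the position of \<open>i\<close> in \<open>K \<union> {i}\<close> and the position
  of \<open>j\<close> in \<open>K \<union> {j}\<close>, that is, the number of transpositions in the aligning cycle.
\<close>

lemma between_count_eq_diff:
  fixes K :: "'n::linorder set"
  assumes "finite K" "i \<notin> K" "i \<le> j"
  shows "between_count i j K = card {k\<in>K. k < j} - card {k\<in>K. k < i}"
    "card {k\<in>K. k < i} \<le> card {k\<in>K. k < j}"
proof -
  have "{k\<in>K. (i < k \<and> k < j) \<or> (j < k \<and> k < i)} = {k\<in>K. k < j} - {k\<in>K. k < i}"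
    using assms by (auto simp: not_less order.order_iff_strict)
  moreover have "{k\<in>K. k < i} \<subseteq> {k\<in>K. k < j}" using assms by auto
  ultimately show "between_count i j K = card {k\<in>K. k < j} - card {k\<in>K. k < i}"
    "card {k\<in>K. k < i} \<le> card {k\<in>K. k < j}"
    using assms(1) by (auto simp: between_count_def card_Diff_subset intro!: card_mono)
qed

lemma exchange_permutation_exists_le:
  fixes K :: "'n::linorder set"
  assumes K: "finite K" "i \<notin> K" "j \<notin> K" and ij: "i \<le> j"
  defines "I \<equiv> sorted_list_of_set (insert i K)" and "J \<equiv> sorted_list_of_set (insert j K)"
    and "a \<equiv> card {k\<in>K. k < i}" and "b \<equiv> card {k\<in>K. k < j}" and "p \<equiv> Suc (card K)"
  obtains \<pi> where "\<pi> permutes {..<p}" "sign \<pi> = (-1) ^ between_count i j K"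
    "\<pi> a = b" "\<And>k. k < p \<Longrightarrow> k \<noteq> a \<Longrightarrow> I ! k = J ! \<pi> k"
proof -
  note q = between_count_eq_diff[OF K(1,2) ij, folded a_def b_def]
  have bp: "b < p" using card_less_le_card[OF K(1), of j] by (simp add: b_def p_def)
  obtain \<pi> where \<pi>: "\<pi> permutes {a..b}" "sign \<pi> = (-1) ^ (b - a)" "\<pi> a = b"
    "\<And>k. a < k \<Longrightarrow> k \<le> b \<Longrightarrow> \<pi> k = k - 1"
    using rotation_permutation_exists[OF q(2)] by blast
  have fixed: "\<pi> k = k" if "k < a \<or> b < k" for k using \<pi>(1) that by (auto intro: permutes_not_in)
  have nI: "I ! k = (if k < a then sorted_list_of_set K ! k else if k = a then i
      else sorted_list_of_set K ! (k - 1))" for k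
    unfolding I_def by (rule nth_sorted_list_of_set_insert[OF K(1,2)]) (simp add: a_def)
  have nJ: "J ! k = (if k < b then sorted_list_of_set K ! k else if k = b then j
      else sorted_list_of_set K ! (k - 1))" for k
    unfolding J_def by (rule nth_sorted_list_of_set_insert[OF K(1,3)]) (simp add: b_def)
  show ?thesis
  proof (rule that)
    show "\<pi> permutes {..<p}" using \<pi>(1) bp by (elim permutes_subset) auto
    show "I ! k = J ! \<pi> k" if "k < p" "k \<noteq> a" for k
      using that \<pi>(4)[of k] fixed[of k] q(2) unfolding nI nJ by (cases "k < a"; cases "k \<le> b") auto
  qed (use \<pi> q in auto)
qed

text \<open>
  The case \<open>j < i\<close> reduces to \<open>i \<le> j\<close> by inverting the permutation, which keeps its sign.
\<close>

lemma exchange_permutation_exists: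
  fixes K :: "'n::linorder set"
  assumes K: "finite K" "i \<notin> K" "j \<notin> K"
  defines "I \<equiv> sorted_list_of_set (insert i K)" and "J \<equiv> sorted_list_of_set (insert j K)"
    and "p \<equiv> Suc (card K)"
  obtains \<pi> m where "\<pi> permutes {..<p}" "sign \<pi> = (-1) ^ between_count i j K" "m < p"
    "I ! m = i" "J ! \<pi> m = j" "\<And>k. k < p \<Longrightarrow> k \<noteq> m \<Longrightarrow> I ! k = J ! \<pi> k"
proof -
  define a where "a = card {k\<in>K. k < i}"
  define b where "b = card {k\<in>K. k < j}"
  have ap: "a < p" using card_less_le_card[OF K(1), of i] by (simp add: a_def p_def)
  have Ia: "I ! a = i" unfolding I_def using nth_sorted_list_of_set_insert[OF K(1,2) a_def] by simp
  have Jb: "J ! b = j" unfolding J_def using nth_sorted_list_of_set_insert[OF K(1,3) b_def] by simp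
  show ?thesis
  proof (cases "i \<le> j")
    case True
    show ?thesis
      by (rule exchange_permutation_exists_le[OF K True, folded a_def b_def I_def J_def p_def])
        (rule that[of _ a], use ap Ia Jb in auto)
  next
    case False
    then have ji: "j \<le> i" by simp
    obtain \<pi> where \<pi>: "\<pi> permutes {..<p}" "sign \<pi> = (-1) ^ between_count j i K"
      "\<pi> b = a" "\<And>k. k < p \<Longrightarrow> k \<noteq> b \<Longrightarrow> J ! k = I ! \<pi> k"
      using exchange_permutation_exists_le[OF K(1,3,2) ji, folded a_def b_def I_def J_def p_def]
      by blast
    have inv: "inv \<pi> permutes {..<p}" by (rule permutes_inv[OF \<pi>(1)])
    have inva: "inv \<pi> a = b" using \<pi>(1,3) permutes_inverses(2) by metis
    show ?thesis
    proof (rule that[of "inv \<pi>" a])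
      show "sign (inv \<pi>) = (-1) ^ between_count i j K"
        using \<pi>(1,2) by (subst sign_inverse) (auto simp: permutation_permutes between_count_commute)
      fix k assume k: "k < p" "k \<noteq> a"
      have "inv \<pi> k < p" using permutes_in_image[OF inv, of k] k by simp
      moreover have "inv \<pi> k \<noteq> b" using k \<pi>(1,3) permutes_inverses(1) by metis
      ultimately have "J ! inv \<pi> k = I ! \<pi> (inv \<pi> k)" by (rule \<pi>(4))
      then show "I ! k = J ! inv \<pi> k" using permutes_inverses(1)[OF \<pi>(1)] by simp
    qed (use inv inva ap Ia Jb in auto)
  qed
qed

lemma image_nth_sorted_list_of_set:
  fixes I :: "'n::{finite,linorder} set"
  assumes "card I = p"
  shows "(!) (sorted_list_of_set I) ` {..<p} = I"
  using assms nth_image[of p "sorted_list_of_set I"] by (simp add: atLeast0LessThan)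

lemma inj_on_nth_sorted_list_of_set:
  fixes I :: "'n::{finite,linorder} set"
  assumes "card I = p"
  shows "inj_on ((!) (sorted_list_of_set I)) {..<p}"
  using assms by (auto simp: inj_on_def nth_eq_iff_index_eq)

text \<open>
  The pairs \<open>(\<pi>, m)\<close> for which, in the Leibniz sum of the minor \<open>I\<close>, \<open>J\<close> of the identity matrix, all
  factors except possibly the one in row position \<open>m\<close> equal 1. These index the nonzero terms of the
  derivative of that minor.
\<close>

definition matching :: "nat \<Rightarrow> 'n::linorder set \<Rightarrow> 'n set \<Rightarrow> ((nat \<Rightarrow> nat) \<times> nat) set"
  where "matching p I J = {(\<pi>, m). \<pi> permutes {..<p} \<and> m < p \<and>
    (\<forall>k<p. k \<noteq> m \<longrightarrow> sorted_list_of_set I ! k = sorted_list_of_set J ! \<pi> k)}"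

text \<open>
  Removing row \<open>m\<close> and its column leaves equal index sets, which gives \<open>I - {i} = J - {j}\<close>. Conversely
  \<open>i\<close> and \<open>j\<close> determine the alignment of the remaining elements, hence \<open>\<pi>\<close>, which therefore is the
  permutation of \<open>exchange_permutation_exists\<close> and has its sign.
\<close>

lemma matching_bij:
  fixes I J :: "'n::{finite,linorder} set"
  assumes c: "card I = p" "card J = p"
  shows "bij_betw (\<lambda>(\<pi>, m). (sorted_list_of_set I ! m, sorted_list_of_set J ! \<pi> m))
      (matching p I J) {(i, j). i \<in> I \<and> j \<in> J \<and> I - {i} = J - {j}}" (is ?A)
    and "(\<pi>, m) \<in> matching p I J \<Longrightarrow> sign \<pi> =
      (-1) ^ between_count (sorted_list_of_set I ! m) (sorted_list_of_set J ! \<pi> m)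
        (I - {sorted_list_of_set I ! m})"
proof -
  let ?I = "(!) (sorted_list_of_set I)" and ?J = "(!) (sorted_list_of_set J)"
  let ?h = "\<lambda>(\<pi>, m). (?I m, ?J (\<pi> m))"
  note imgI = image_nth_sorted_list_of_set[OF c(1)] and imgJ = image_nth_sorted_list_of_set[OF c(2)]
  note injI = inj_on_nth_sorted_list_of_set[OF c(1)] and injJ = inj_on_nth_sorted_list_of_set[OF c(2)]
  have lt: "\<pi> k < p" if "\<pi> permutes {..<p}" "k < p" for \<pi> k
    using permutes_in_image[OF that(1), of k] that(2) by simp
  have inj: "inj_on ?h (matching p I J)"
  proof (rule inj_onI, clarify)
    fix \<pi> m \<pi>' m'
    assume 1: "(\<pi>, m) \<in> matching p I J" "(\<pi>', m') \<in> matching p I J"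
      and 2: "?I m = ?I m'" "?J (\<pi> m) = ?J (\<pi>' m')"
    have \<pi>: "\<pi> permutes {..<p}" "\<pi>' permutes {..<p}" and "m < p" "m' < p"
      using 1 by (simp_all add: matching_def)
    then have m: "m = m'" using inj_onD[OF injI 2(1)] by simp
    have "?J (\<pi> k) = ?J (\<pi>' k)" if "k < p" for k
      using 1 2 m that by (cases "k = m") (auto simp: matching_def)
    then have "\<pi> k = \<pi>' k" if "k < p" for k
      using that lt[OF \<pi>(1) that] lt[OF \<pi>(2) that] by (intro inj_onD[OF injJ]) auto
    moreover have "\<pi> k = \<pi>' k" if "\<not> k < p" for k
      using that permutes_not_in[OF \<pi>(1), of k] permutes_not_in[OF \<pi>(2), of k] by simp
    ultimately show "\<pi> = \<pi>' \<and> m = m'" using m by blast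
  qed
  have into: "?I m \<in> I" "?J (\<pi> m) \<in> J" "I - {?I m} = J - {?J (\<pi> m)}"
    if "(\<pi>, m) \<in> matching p I J" for \<pi> m
  proof -
    have \<pi>: "\<pi> permutes {..<p}" and m: "m < p"
      and eq: "\<And>k. k \<in> {..<p} - {m} \<Longrightarrow> ?I k = ?J (\<pi> k)"
      using that by (auto simp: matching_def)
    show "?I m \<in> I" "?J (\<pi> m) \<in> J" using imgI imgJ m lt[OF \<pi> m] by blast+
    have "I - {?I m} = ?I ` ({..<p} - {m})"
      using inj_on_image_set_diff[OF injI, of "{..<p}" "{m}"] m imgI by auto
    also have "\<dots> = ?J ` \<pi> ` ({..<p} - {m})" using eq by (simp add: image_image)
    also have "\<pi> ` ({..<p} - {m}) = {..<p} - {\<pi> m}"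
      using \<pi> by (simp add: image_set_diff permutes_inj permutes_image)
    also have "?J ` ({..<p} - {\<pi> m}) = J - {?J (\<pi> m)}"
      using inj_on_image_set_diff[OF injJ, of "{..<p}" "{\<pi> m}"] lt[OF \<pi> m] imgJ by auto
    finally show "I - {?I m} = J - {?J (\<pi> m)}" .
  qed
  have ex: "\<exists>\<pi> m. (\<pi>, m) \<in> matching p I J \<and> ?I m = i \<and> ?J (\<pi> m) = j \<and>
      sign \<pi> = (-1) ^ between_count i j (I - {i})"
    if ij: "i \<in> I" "j \<in> J" "I - {i} = J - {j}" for i j
  proof -
    define K where "K = I - {i}"
    have I: "insert i K = I" and J: "insert j K = J" and K: "i \<notin> K" "j \<notin> K" and p: "Suc (card K) = p"
      using ij c card_Suc_Diff1[of I i] by (auto simp: K_def)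
    show ?thesis
      by (rule exchange_permutation_exists[OF finite_code[of K, THEN iffD2] K, unfolded I J p])
        (auto simp: matching_def K_def)
  qed
  have "?h ` matching p I J = {(i, j). i \<in> I \<and> j \<in> J \<and> I - {i} = J - {j}}"
  proof (intro equalityI subsetI)
    fix x assume "x \<in> ?h ` matching p I J"
    then obtain \<pi> m where "x = (?I m, ?J (\<pi> m))" "(\<pi>, m) \<in> matching p I J" by auto
    then show "x \<in> {(i, j). i \<in> I \<and> j \<in> J \<and> I - {i} = J - {j}}"
      using into[of \<pi> m] by (simp only: mem_Collect_eq case_prod_conv)
  next
    fix x assume "x \<in> {(i, j). i \<in> I \<and> j \<in> J \<and> I - {i} = J - {j}}"
    then obtain i j where x: "x = (i, j)" "i \<in> I" "j \<in> J" "I - {i} = J - {j}" by auto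
    then obtain \<pi> m where "(\<pi>, m) \<in> matching p I J" "?I m = i" "?J (\<pi> m) = j"
      using ex by blast
    then show "x \<in> ?h ` matching p I J" using x by (intro image_eqI[of _ _ "(\<pi>, m)"]) auto
  qed
  with inj show ?A by (rule bij_betw_imageI)
  assume mem: "(\<pi>, m) \<in> matching p I J"
  from ex[OF into[OF mem]] obtain \<pi>' m' where *: "(\<pi>', m') \<in> matching p I J" "?I m' = ?I m"
    "?J (\<pi>' m') = ?J (\<pi> m)" "sign \<pi>' = (-1) ^ between_count (?I m) (?J (\<pi> m)) (I - {?I m})"
    by blast
  have "(\<pi>', m') = (\<pi>, m)" by (rule inj_onD[OF inj _ *(1) mem]) (use * in simp)
  with * show "sign \<pi> = (-1) ^ between_count (?I m) (?J (\<pi> m)) (I - {?I m})" by simp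
qed

lemma prod_of_bool: "finite S \<Longrightarrow> (\<Prod>k\<in>S. of_bool (P k)) = (of_bool (\<forall>k\<in>S. P k) :: real)"
  by (induction S rule: finite_induct) auto

lemma mat_1_nth: "(mat 1 :: real^'n^'n) $ i $ j = of_bool (i = j)"
  by (simp add: mat_def)

lemma minor_mat_1:
  fixes I J :: "'n::{finite,wellorder} set"
  assumes c: "card I = p" "card J = p"
  shows "minor p (mat 1) I J = of_bool (I = J)"
proof -
  let ?I = "(!) (sorted_list_of_set I)" and ?J = "(!) (sorted_list_of_set J)"
  have "minor p (mat 1) I J = (\<Sum>\<pi> | \<pi> permutes {..<p}. of_int (sign \<pi>) * of_bool (\<forall>k\<in>{..<p}. ?I k = ?J (\<pi> k)))"
    by (simp add: minor_def mat_1_nth prod_of_bool)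
  also have "\<dots> = (\<Sum>\<pi> | \<pi> permutes {..<p}. if \<pi> = id then of_bool (I = J) else 0)"
  proof (rule sum.cong[OF refl], clarify)
    fix \<pi> assume \<pi>: "\<pi> permutes {..<p}"
    have *: "I = J \<and> \<pi> = id" if eq: "\<forall>k\<in>{..<p}. ?I k = ?J (\<pi> k)"
    proof
      have "I = ?J ` \<pi> ` {..<p}"
        using image_nth_sorted_list_of_set[OF c(1)] eq by (force simp: image_image)
      then show IJ: "I = J" using image_nth_sorted_list_of_set[OF c(2)] permutes_image[OF \<pi>] by simp
      have "\<pi> k = k" if "k < p" for k
        using eq IJ that permutes_in_image[OF \<pi>, of k] inj_on_nth_sorted_list_of_set[OF c(2)]
        by (auto simp: inj_on_def)
      then have "\<pi> k = id k" for k
        using permutes_not_in[OF \<pi>, of k] by (cases "k < p") auto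
      then show "\<pi> = id" by blast
    qed
    then show "of_int (sign \<pi>) * of_bool (\<forall>k\<in>{..<p}. ?I k = ?J (\<pi> k)) =
        (if \<pi> = id then of_bool (I = J) else (0::real))"
    proof (cases "\<forall>k\<in>{..<p}. ?I k = ?J (\<pi> k)")
      case True
      then show ?thesis using *[OF True] by (simp add: sign_id)
    next
      case False
      then have "\<not> (\<pi> = id \<and> I = J)" by auto
      with False show ?thesis by auto
    qed
  qed
  also have "\<dots> = of_bool (I = J)"
    by (simp add: sum.delta' finite_permutations permutes_id)
  finally show ?thesis .
qed

text \<open>
  By the product rule the derivative is a double sum over \<open>\<pi>\<close> and the row position \<open>m\<close> that is
  differentiated. All other factors are entries of the identity matrix, so only the pairs in
  \<open>matching\<close> survive, and these are reindexed by \<open>matching_bij\<close>.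
\<close>

lemma minor_has_real_derivative_at_mat_1:
  fixes W :: "real \<Rightarrow> real^'n::{finite,wellorder}^'n::_"
  assumes W: "\<And>i j. ((\<lambda>t. W t $ i $ j) has_real_derivative N i j) (at 0)" "W 0 = mat 1"
    and c: "card I = p" "card J = p"
  shows "((\<lambda>t. minor p (W t) I J) has_real_derivative
    (\<Sum>(i, j) | i \<in> I \<and> j \<in> J \<and> I - {i} = J - {j}. (-1) ^ between_count i j (I - {i}) * N i j)) (at 0)"
proof -
  let ?I = "(!) (sorted_list_of_set I)" and ?J = "(!) (sorted_list_of_set J)"
  let ?P = "{\<pi>. \<pi> permutes {..<p}}"
  have fin: "finite (?P \<times> {..<p})" by (simp add: finite_permutations)
  have "((\<lambda>t. minor p (W t) I J) has_real_derivative
      (\<Sum>\<pi>\<in>?P. of_int (sign \<pi>) * (\<Sum>m<p. N (?I m) (?J (\<pi> m)) *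
        (\<Prod>k\<in>{..<p} - {m}. W 0 $ ?I k $ ?J (\<pi> k))))) (at 0)"
    unfolding minor_def by (intro DERIV_sum DERIV_cmult has_field_derivative_prod W(1))
  moreover have "(\<Sum>\<pi>\<in>?P. of_int (sign \<pi>) * (\<Sum>m<p. N (?I m) (?J (\<pi> m)) *
        (\<Prod>k\<in>{..<p} - {m}. W 0 $ ?I k $ ?J (\<pi> k))))
      = (\<Sum>(\<pi>, m)\<in>?P \<times> {..<p}. of_int (sign \<pi>) * (N (?I m) (?J (\<pi> m)) *
          of_bool (\<forall>k\<in>{..<p} - {m}. ?I k = ?J (\<pi> k))))"
    unfolding W(2) mat_1_nth sum_distrib_left
    by (subst sum.cartesian_product) (simp add: prod_of_bool)
  also have "\<dots> = (\<Sum>(\<pi>, m)\<in>matching p I J. of_int (sign \<pi>) * N (?I m) (?J (\<pi> m)))"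
    by (rule sum.mono_neutral_cong_right[OF fin]) (auto simp: matching_def)
  also have "\<dots> = (\<Sum>x\<in>matching p I J. (\<lambda>(i, j). (-1) ^ between_count i j (I - {i}) * N i j)
      ((\<lambda>(\<pi>, m). (?I m, ?J (\<pi> m))) x))"
    by (rule sum.cong[OF refl]) (auto simp: matching_bij(2)[OF c])
  also have "\<dots> = (\<Sum>(i, j) | i \<in> I \<and> j \<in> J \<and> I - {i} = J - {j}. (-1) ^ between_count i j (I - {i}) * N i j)"
    by (rule sum.reindex_bij_betw[OF matching_bij(1)[OF c]])
  finally show ?thesis by simp
qed

text \<open>
  A permutation other than the identity moves at least two points, so each of its terms in the
  product rule still contains a vanishing off-diagonal entry; only the trace remains.
\<close>

lemma det_has_real_derivative_at_mat_1:
  fixes M :: "real \<Rightarrow> real^'n^'n"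
  assumes M: "\<And>i j. ((\<lambda>t. M t $ i $ j) has_real_derivative N i j) (at 0)" "M 0 = mat 1"
  shows "((\<lambda>t. det (M t)) has_real_derivative (\<Sum>i\<in>UNIV. N i i)) (at 0)"
proof -
  let ?P = "{\<pi>. \<pi> permutes (UNIV :: 'n set)}"
  have "((\<lambda>t. det (M t)) has_real_derivative
      (\<Sum>\<pi>\<in>?P. of_int (sign \<pi>) * (\<Sum>m\<in>UNIV. N m (\<pi> m) * (\<Prod>k\<in>UNIV - {m}. M 0 $ k $ \<pi> k)))) (at 0)"
    unfolding det_def by (intro DERIV_sum DERIV_cmult has_field_derivative_prod M(1))
  moreover have "(\<Sum>\<pi>\<in>?P. of_int (sign \<pi>) * (\<Sum>m\<in>UNIV. N m (\<pi> m) * (\<Prod>k\<in>UNIV - {m}. M 0 $ k $ \<pi> k)))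
      = (\<Sum>\<pi>\<in>?P. if \<pi> = id then \<Sum>m\<in>UNIV. N m m else 0)"
  proof (rule sum.cong[OF refl], clarify)
    fix \<pi> :: "'n \<Rightarrow> 'n" assume \<pi>: "\<pi> permutes UNIV"
    have none: "\<not> (\<forall>k\<in>UNIV - {m}. k = \<pi> k)" if ne: "\<pi> \<noteq> id" for m
    proof -
      obtain x where x: "\<pi> x \<noteq> x" using ne by (auto simp: fun_eq_iff)
      then have "\<pi> (\<pi> x) \<noteq> \<pi> x" using permutes_inj[OF \<pi>] by (auto simp: inj_def)
      then show ?thesis using x by (metis DiffI UNIV_I singletonD)
    qed
    show "of_int (sign \<pi>) * (\<Sum>m\<in>UNIV. N m (\<pi> m) * (\<Prod>k\<in>UNIV - {m}. M 0 $ k $ \<pi> k)) =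
        (if \<pi> = id then \<Sum>m\<in>UNIV. N m m else 0)"
    proof (cases "\<pi> = id")
      case True
      then show ?thesis by (simp add: M(2) mat_1_nth sign_id)
    next
      case False
      have zero: "(\<Prod>k\<in>UNIV - {m}. M 0 $ k $ \<pi> k) = 0" for m
        using none[OF False, of m] by (simp add: M(2) mat_1_nth prod_of_bool)
      show ?thesis using False by (simp only: zero) simp
    qed
  qed
  moreover have "\<dots> = (\<Sum>i\<in>UNIV. N i i)"
    by (simp add: sum.delta' finite_permutations permutes_id)
  ultimately show ?thesis by simp
qed

section \<open>The first variation\<close>

text \<open>
  From \<open>W M = 1\<close> one gets \<open>W - 1 = W (1 - M)\<close>. As \<open>W\<close> is bounded this first shows that \<open>W\<close> is
  continuous at 0; dividing by \<open>t\<close> then gives the derivative.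

  In the application \<open>W t\<close> is the Jacobian matrix of \<open>\<phi> t\<close> at the moving point \<open>\<phi> (-t) y\<close>. Passing to
  its inverse \<open>M t\<close>, the Jacobian matrix of \<open>\<phi> (-t)\<close> at the fixed point \<open>y\<close>, avoids differentiating
  Jacobian matrices in space.
\<close>

lemma left_inverse_matrix_has_derivative:
  fixes W M :: "real \<Rightarrow> real^'n^'n"
  assumes M: "\<And>i j. ((\<lambda>t. M t $ i $ j) has_real_derivative - N i j) (at 0)" "M 0 = mat 1"
    and WM: "\<And>t. W t ** M t = mat 1" "W 0 = mat 1"
    and bound: "\<And>t i j. \<bar>t\<bar> < 1 \<Longrightarrow> \<bar>W t $ i $ j\<bar> \<le> C"
  shows "((\<lambda>t. W t $ i $ j) has_real_derivative N i j) (at 0)"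
proof -
  define E where "E t c j = mat 1 $ c $ j - M t $ c $ j" for t c j
  have diff: "W t $ i $ j - mat 1 $ i $ j = (\<Sum>c\<in>UNIV. W t $ i $ c * E t c j)" for t i j
  proof -
    have "(\<Sum>c\<in>UNIV. W t $ i $ c * E t c j) = (W t ** mat 1) $ i $ j - (W t ** M t) $ i $ j"
      by (simp add: E_def matrix_matrix_mult_def right_diff_distrib sum_subtractf)
    then show ?thesis by (simp add: WM)
  qed
  have E0: "((\<lambda>t. E t c j) \<longlongrightarrow> 0) (at 0)" for c j
  proof -
    have "isCont (\<lambda>t. M t $ c $ j) 0" by (rule DERIV_isCont[OF M(1)])
    then have "((\<lambda>t. M t $ c $ j) \<longlongrightarrow> mat 1 $ c $ j) (at 0)" by (simp add: isCont_def M(2))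
    then have "((\<lambda>t. E t c j) \<longlongrightarrow> mat 1 $ c $ j - mat 1 $ c $ j) (at 0)"
      unfolding E_def by (intro tendsto_diff tendsto_const)
    then show ?thesis by simp
  qed
  have W0: "((\<lambda>t. W t $ i $ j) \<longlongrightarrow> mat 1 $ i $ j) (at 0)" for i j
  proof (rule LIM_zero_cancel, rule Lim_null_comparison)
    have "\<forall>\<^sub>F t in at (0::real). \<bar>t\<bar> < 1"
      by (auto simp: eventually_at dist_norm intro!: exI[of _ 1])
    then show "\<forall>\<^sub>F t in at 0. norm (W t $ i $ j - mat 1 $ i $ j) \<le> (\<Sum>c\<in>UNIV. C * \<bar>E t c j\<bar>)"
    proof eventually_elim
      case (elim t)
      show ?case unfolding diff real_norm_def
        by (rule order_trans[OF sum_abs sum_mono]) (simp add: abs_mult mult_right_mono bound elim)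
    qed
    have "((\<lambda>t. \<Sum>c\<in>UNIV. C * \<bar>E t c j\<bar>) \<longlongrightarrow> (\<Sum>c\<in>(UNIV::'n set). C * \<bar>0\<bar>)) (at 0)"
      by (intro tendsto_sum tendsto_mult tendsto_const tendsto_rabs E0)
    then show "((\<lambda>t. \<Sum>c\<in>UNIV. C * \<bar>E t c j\<bar>) \<longlongrightarrow> 0) (at 0)" by simp
  qed
  have E': "((\<lambda>t. E t c j / t) \<longlongrightarrow> N c j) (at 0)" for c j
  proof -
    have "((\<lambda>t. (M t $ c $ j - M 0 $ c $ j) / (t - 0)) \<longlongrightarrow> - N c j) (at 0)"
      using M(1)[of c j] by (simp add: has_field_derivative_iff)
    from tendsto_minus[OF this] show ?thesis
      by (simp add: E_def M(2) minus_divide_left)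
  qed
  have "((\<lambda>t. \<Sum>c\<in>UNIV. W t $ i $ c * (E t c j / t)) \<longlongrightarrow> (\<Sum>c\<in>UNIV. mat 1 $ i $ c * N c j)) (at 0)"
    by (intro tendsto_sum tendsto_mult W0 E')
  moreover have "(\<Sum>c\<in>UNIV. mat 1 $ i $ c * N c j) = N i j"
    by (simp add: mat_def if_distrib[of "\<lambda>x. x * _"] cong: if_cong)
  moreover have "(\<Sum>c\<in>UNIV. W t $ i $ c * (E t c j / t)) = (W t $ i $ j - W 0 $ i $ j) / (t - 0)" for t
    by (simp add: WM(2) diff sum_divide_distrib)
  ultimately show ?thesis by (simp add: has_field_derivative_iff)
qed

lemma Basis_Int_Lam: "(Basis \<inter> Lam p :: (real^'n::finite set) set) = (\<lambda>J. axis J 1) ` {J. card J = p}"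
  by (auto simp: Lam_def Basis_vec_def axis_def)

lemma subspace_Lam: "subspace (Lam p)"
  by (auto simp: subspace_def Lam_def)

lemma Lam_inner_eq_0:
  fixes v :: "real^('n::finite set)"
  assumes "v \<in> Lam p" "b \<in> Basis - Lam p"
  shows "v \<bullet> b = 0"
proof -
  obtain J where J: "b = axis J 1" using assms(2) by (auto simp: Basis_vec_def)
  have "axis J 1 \<in> (Lam p :: (real^'n set) set)" if "card J = p"
    using Basis_Int_Lam[of p] that by blast
  then have "card J \<noteq> p" using assms(2) J by blast
  then show ?thesis using assms(1) J by (simp add: Lam_def inner_axis)
qed

lemma smooth_on_Lam_has_derivative:
  fixes L :: "real^('n::finite set) \<Rightarrow> real"
  assumes "smooth_on_coord_subspace (Lam p) L" "a \<in> Lam p"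
  shows "(L has_derivative (\<lambda>h. \<Sum>J | card J = p. h $ J * pdv (axis J 1) L a)) (at a within Lam p)"
proof -
  have inj: "inj_on (\<lambda>J::'n set. axis J (1::real)) {J. card J = p}"
    by (auto simp: inj_on_def axis_eq_axis)
  have "Ck_on (Lam p) (Suc 0) L" using assms unfolding smooth_on_coord_subspace_def by blast
  from Ck_on_imp_has_derivative_within[OF subspace_Lam Lam_inner_eq_0 this assms(2)]
  show ?thesis by (simp add: Basis_Int_Lam sum.reindex[OF inj] inner_axis)
qed

text \<open>
  Since \<open>L\<close> is differentiable only within \<open>Lam p\<close>, the chain rule needs the curve to stay there.
\<close>

lemma has_real_derivative_along_curve_in_Lam:
  fixes L :: "real^('n::finite set) \<Rightarrow> real"
  assumes L: "smooth_on_coord_subspace (Lam p) L" and B: "\<And>t. B t \<in> Lam p"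
    and B': "\<And>J. card J = p \<Longrightarrow> ((\<lambda>t. B t $ J) has_real_derivative B' J) (at 0)"
  shows "((\<lambda>t. L (B t)) has_real_derivative (\<Sum>J | card J = p. B' J * pdv (axis J 1) L (B 0))) (at 0)"
proof -
  define b where "b = (\<chi> J. if card J = p then B' J else 0)"
  have "((\<lambda>t. B t $ J) has_real_derivative b $ J) (at 0)" for J
    using B B'[of J] by (cases "card J = p") (auto simp: b_def Lam_def)
  then have "((\<lambda>t. B t $ J) has_derivative (\<lambda>t. t * b $ J)) (at 0)" for J
    by (simp add: has_field_derivative_def mult_commute_abs)
  then have "(B has_derivative (\<lambda>t. t *\<^sub>R b)) (at 0)"
    by (intro iffD2[OF has_derivative_componentwise_within])
      (auto simp: Basis_vec_def inner_axis)
  moreover have "(L has_derivative (\<lambda>h. \<Sum>J | card J = p. h $ J * pdv (axis J 1) L (B 0)))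
      (at (B 0) within range B)"
    by (rule has_derivative_subset[OF smooth_on_Lam_has_derivative[OF L B]]) (use B in auto)
  ultimately have "((\<lambda>t. L (B t)) has_derivative
      (\<lambda>t. \<Sum>J | card J = p. (t *\<^sub>R b) $ J * pdv (axis J 1) L (B 0))) (at 0)"
    by (rule has_derivative_in_compose)
  moreover have "(\<Sum>J | card J = p. (t *\<^sub>R b) $ J * pdv (axis J 1) L (B 0)) =
      (\<Sum>J | card J = p. B' J * pdv (axis J 1) L (B 0)) * t" for t
    unfolding sum_distrib_right by (rule sum.cong) (auto simp: b_def)
  ultimately show ?thesis by (simp add: has_field_derivative_def)
qed

text \<open>
  The correspondence is \<open>K = I - {i} = J - {j}\<close>, \<open>I = insert i K\<close>, \<open>J = insert j K\<close>. It translates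
  between the sum over minors and the sum in \<open>T_tensor\<close>.
\<close>

lemma sum_exchange_reindex:
  fixes F :: "'n::{finite,linorder} \<Rightarrow> 'n \<Rightarrow> 'n set \<Rightarrow> 'n set \<Rightarrow> 'n set \<Rightarrow> real"
  assumes p: "1 \<le> p"
  shows "(\<Sum>J | card J = p. \<Sum>I | card I = p. \<Sum>(i, j) | i \<in> I \<and> j \<in> J \<and> I - {i} = J - {j}.
      F i j (I - {i}) I J)
    = (\<Sum>i\<in>UNIV. \<Sum>j\<in>UNIV. \<Sum>K | card K = p - 1 \<and> i \<notin> K \<and> j \<notin> K. F i j K (insert i K) (insert j K))"
proof -
  let ?R = "\<lambda>I J. {(i, j). i \<in> I \<and> j \<in> J \<and> I - {i} = J - {j}}"
  have "(\<Sum>J | card J = p. \<Sum>I | card I = p. \<Sum>(i, j)\<in>?R I J. F i j (I - {i}) I J)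
      = (\<Sum>(J, I, i, j)\<in>(SIGMA J:{J. card J = p}. SIGMA I:{I. card I = p}. ?R I J).
          F i j (I - {i}) I J)"
    by (simp add: sum.Sigma)
  also have "\<dots> = (\<Sum>(i, j, K)\<in>(SIGMA i:UNIV. SIGMA j:UNIV. {K. card K = p - 1 \<and> i \<notin> K \<and> j \<notin> K}).
      F i j K (insert i K) (insert j K))"
  proof (rule sum.reindex_bij_witness[where i = "\<lambda>(i, j, K). (insert j K, insert i K, i, j)"
          and j = "\<lambda>(J, I, i, j). (i, j, I - {i})"])
    fix x :: "'n set \<times> 'n set \<times> 'n \<times> 'n"
    assume "x \<in> (SIGMA J:{J. card J = p}. SIGMA I:{I. card I = p}. ?R I J)"
    then obtain J I i j where x: "x = (J, I, i, j)" "card J = p" "card I = p" "i \<in> I" "j \<in> J"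
      "I - {i} = J - {j}" by auto
    then have "insert j (I - {i}) = J" "insert i (I - {i}) = I" "card (I - {i}) = p - 1" "j \<notin> I - {i}"
      by auto
    then show "(case case x of (J, I, i, j) \<Rightarrow> (i, j, I - {i}) of (i, j, K) \<Rightarrow> (insert j K, insert i K, i, j)) = x"
      "(case x of (J, I, i, j) \<Rightarrow> (i, j, I - {i})) \<in> (SIGMA i:UNIV. SIGMA j:UNIV. {K. card K = p - 1 \<and> i \<notin> K \<and> j \<notin> K})"
      "(case case x of (J, I, i, j) \<Rightarrow> (i, j, I - {i}) of (i, j, K) \<Rightarrow> F i j K (insert i K) (insert j K)) =
        (case x of (J, I, i, j) \<Rightarrow> F i j (I - {i}) I J)"
      by (simp_all add: x(1))
  next
    fix x :: "'n \<times> 'n \<times> 'n set"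
    assume "x \<in> (SIGMA i:UNIV. SIGMA j:UNIV. {K. card K = p - 1 \<and> i \<notin> K \<and> j \<notin> K})"
    then obtain i j K where x: "x = (i, j, K)" "card K = p - 1" "i \<notin> K" "j \<notin> K" by auto
    then have "insert i K - {i} = K" "insert j K - {j} = K" "card (insert i K) = p" "card (insert j K) = p"
      using p by auto
    then show "(case case x of (i, j, K) \<Rightarrow> (insert j K, insert i K, i, j) of (J, I, i, j) \<Rightarrow> (i, j, I - {i})) = x"
      "(case x of (i, j, K) \<Rightarrow> (insert j K, insert i K, i, j)) \<in> (SIGMA J:{J. card J = p}. SIGMA I:{I. card I = p}. ?R I J)"
      by (simp_all add: x(1))
  qed
  also have "\<dots> = (\<Sum>i\<in>UNIV. \<Sum>j\<in>UNIV. \<Sum>K | card K = p - 1 \<and> i \<notin> K \<and> j \<notin> K. F i j K (insert i K) (insert j K))"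
    by (simp add: sum.Sigma)
  finally show ?thesis .
qed

lemma pullback_nth:
  "pullback p \<phi> A z $ J = (if card J = p
    then \<Sum>I | card I = p. A (\<phi> z) $ I * minor p (jacobian \<phi> (at z)) I J else 0)"
  by (simp add: pullback_def wedge_rows_nth)

text \<open>
  This is the pointwise computation behind the tensor \<open>T\<close>: the transported integrand is
  \<open>L (B \<epsilon>) det (M \<epsilon>)\<close>, where \<open>M\<close> is the inverse of \<open>W\<close> and \<open>B\<close> is a combination of minors of \<open>W\<close> with
  coefficients \<open>A y\<close> that do not depend on \<open>\<epsilon>\<close>.
\<close>

lemma transported_integrand_has_derivative:
  fixes D :: "(real^'n::{finite,wellorder}) set"
  assumes \<xi>: "\<xi> \<in> test_fields D" and flow: "is_flow_of \<phi> \<xi> D" and D: "open D" and y: "y \<in> D"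
    and L: "smooth_on_coord_subspace (Lam p) L" and A: "A y \<in> Lam p" and p: "1 \<le> p"
  shows "((\<lambda>\<epsilon>. transported_integrand p L A \<phi> \<epsilon> y) has_real_derivative
    - (\<Sum>i\<in>UNIV. \<Sum>j\<in>UNIV. T_tensor p L A i j y * pdv (axis j 1) (\<lambda>y. \<xi> y $ i) y)) (at 0)"
proof -
  obtain K where "C11_field \<xi> (field_derivative \<xi>) K" using test_field_is_C11_field[OF \<xi>] .
  then interpret C11_field \<xi> "field_derivative \<xi>" K .
  define N where "N i j = pdv (axis j 1) (\<lambda>y. \<xi> y $ i) y" for i j
  define M where "M \<epsilon> = jacobian (\<phi> (- \<epsilon>)) (at y)" for \<epsilon>
  define W where "W \<epsilon> = jacobian (\<phi> \<epsilon>) (at (\<phi> (- \<epsilon>) y))" for \<epsilon>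
  define q where "q J = pdv (axis J 1) L (A y)" for J
  have M0: "M 0 = mat 1" and W0: "W 0 = mat 1"
    using flow_jacobian(4)[OF flow D y] flow_0[OF flow y] by (simp_all add: M_def W_def)
  have WM: "W t ** M t = mat 1" for t
    using flow_jacobian_inverse[OF flow D y, of "- t"] by (simp add: W_def M_def)
  have M': "((\<lambda>t. M t $ i $ j) has_real_derivative - N i j) (at 0)" for i j
  proof -
    have "field_derivative \<xi> y (axis j 1) $ i = N i j"
      by (simp add: field_derivative_def N_def axis_def if_distrib[of "\<lambda>x. x * _"] cong: if_cong)
    then have "((\<lambda>t. jacobian (\<phi> t) (at y) $ i $ j) has_real_derivative N i j) (at (- 0))"
      using flow_jacobian(3)[OF flow D y, of i j 0] flow_jacobian(4)[OF flow D y] flow_0[OF flow y]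
      by simp
    then show ?thesis unfolding M_def using DERIV_mirror by fastforce
  qed
  have W': "((\<lambda>t. W t $ i $ j) has_real_derivative N i j) (at 0)" for i j
  proof (rule left_inverse_matrix_has_derivative[OF M' M0 WM W0])
    fix t :: real and i j assume t: "\<bar>t\<bar> < 1"
    have "\<bar>W t $ i $ j\<bar> = \<bar>(W t *v axis j 1) $ i\<bar>" by (simp add: matrix_vector_mult_basis column_def)
    also have "\<dots> \<le> norm (W t *v axis j 1)" by (rule component_le_norm_cart)
    also have "\<dots> \<le> norm (axis j 1 :: real^'n::_) * growth t"
      unfolding W_def by (rule flow_jacobian(2)[OF flow D flow_in[OF flow y]])
    also have "\<dots> \<le> growth 1" using growth_mono[of t 1] t by simp
    finally show "\<bar>W t $ i $ j\<bar> \<le> growth 1" .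
  qed
  define B where "B \<epsilon> = pullback p (\<phi> \<epsilon>) A (\<phi> (- \<epsilon>) y)" for \<epsilon>
  have B: "B \<epsilon> $ J = (if card J = p then \<Sum>I | card I = p. A y $ I * minor p (W \<epsilon>) I J else 0)" for \<epsilon> J
    using flow_inverse(2)[OF flow y] by (simp add: B_def pullback_nth W_def)
  have B0: "B 0 = A y"
  proof (rule vec_eq_iff[THEN iffD2], rule allI)
    fix J
    have "B 0 $ J = (if card J = p then \<Sum>I | card I = p. if I = J then A y $ I else 0 else 0)"
      unfolding B W0 by (auto simp: minor_mat_1 intro!: sum.cong)
    also have "\<dots> = A y $ J" using A by (auto simp: sum.delta' Lam_def)
    finally show "B 0 $ J = A y $ J" .
  qed
  define B' where "B' J = (\<Sum>I | card I = p. A y $ I *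
    (\<Sum>(i, j) | i \<in> I \<and> j \<in> J \<and> I - {i} = J - {j}. (-1) ^ between_count i j (I - {i}) * N i j))" for J
  have "((\<lambda>t. B t $ J) has_real_derivative B' J) (at 0)" if "card J = p" for J
    unfolding B B'_def using that
    by (auto intro!: DERIV_sum DERIV_cmult minor_has_real_derivative_at_mat_1 W' W0)
  moreover have "B t \<in> Lam p" for t by (simp add: Lam_def B)
  ultimately have LB: "((\<lambda>t. L (B t)) has_real_derivative (\<Sum>J | card J = p. B' J * q J)) (at 0)"
    using has_real_derivative_along_curve_in_Lam[OF L, of B B'] by (simp add: B0 q_def)
  have detM: "((\<lambda>t. det (M t)) has_real_derivative (\<Sum>i\<in>UNIV. - N i i)) (at 0)"
    by (rule det_has_real_derivative_at_mat_1[OF M' M0])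
  have eq: "transported_integrand p L A \<phi> t y = L (B t) * det (M t)" for t
  proof -
    have "det (W t) * det (M t) = 1" using WM[of t] by (metis det_I det_mul)
    then have "det (M t) = 1 / det (W t)"
      by (metis mult.commute mult_zero_left nonzero_eq_divide_eq zero_neq_one)
    then show ?thesis by (simp add: transported_integrand_def B_def W_def)
  qed
  have "((\<lambda>t. transported_integrand p L A \<phi> t y) has_real_derivative
      (\<Sum>J | card J = p. B' J * q J) - L (A y) * (\<Sum>i\<in>UNIV. N i i)) (at 0)"
    unfolding eq using DERIV_mult[OF LB detM] by (simp add: M0 B0 sum_negf algebra_simps)
  moreover have "(\<Sum>J | card J = p. B' J * q J) =
      (\<Sum>J | card J = p. \<Sum>I | card I = p. \<Sum>(i, j) | i \<in> I \<and> j \<in> J \<and> I - {i} = J - {j}.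
        (-1) ^ between_count i j (I - {i}) * A y $ I * q J * N i j)"
    unfolding B'_def sum_distrib_left sum_distrib_right
    by (intro sum.cong refl) (simp (no_asm) add: split_beta ac_simps)
  moreover have "\<dots> = (\<Sum>i\<in>UNIV. \<Sum>j\<in>UNIV. \<Sum>K | card K = p - 1 \<and> i \<notin> K \<and> j \<notin> K.
      (-1) ^ between_count i j K * A y $ insert i K * q (insert j K) * N i j)"
    by (rule sum_exchange_reindex[OF p])
  moreover have "L (A y) * (\<Sum>i\<in>UNIV. N i i) =
      (\<Sum>i\<in>UNIV. \<Sum>j\<in>UNIV. L (A y) * (if i = j then 1 else 0) * N i j)"
    by (simp add: sum_distrib_left if_distrib[of "\<lambda>x. _ * x * _"] cong: if_cong)
  ultimately show ?thesis
    by (simp add: T_tensor_def N_def q_def left_diff_distrib sum_subtractf sum_distrib_right)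
qed

lemma locally_integrable_mult_test_function:
  fixes f :: "real^'n \<Rightarrow> real"
  assumes f: "locally_integrable D f" and \<psi>: "\<psi> \<in> test_functions D"
  shows "set_integrable lebesgue D (\<lambda>y. f y * \<psi> y)"
proof -
  let ?S = "closure (support_on UNIV \<psi>)"
  obtain B where B: "\<And>x. \<bar>\<psi> x\<bar> \<le> B" using test_function_bounded[OF \<psi>] by blast
  have S: "compact ?S" "?S \<subseteq> D" using \<psi> by (auto simp: test_functions_def)
  then have fS: "integrable lebesgue (\<lambda>y. indicator ?S y *\<^sub>R f y)"
    using f by (simp add: locally_integrable_def set_integrable_def)
  have "\<psi> \<in> borel_measurable lborel"
    using borel_measurable_continuous_onI[OF test_function_continuous_on[OF \<psi>]] by simp
  then have meas: "\<psi> \<in> borel_measurable lebesgue" by (rule measurable_completion)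
  have "integrable lebesgue (\<lambda>y. (indicator ?S y *\<^sub>R f y) * \<psi> y)"
  proof (rule Bochner_Integration.integrable_bound)
    show "integrable lebesgue (\<lambda>y. B * (indicator ?S y *\<^sub>R f y))"
      using fS by (rule integrable_mult_right)
    show "(\<lambda>y. (indicator ?S y *\<^sub>R f y) * \<psi> y) \<in> borel_measurable lebesgue"
      by (rule borel_measurable_times[OF borel_measurable_integrable[OF fS] meas])
    have "B \<ge> 0" using B abs_ge_zero order_trans by blast
    then show "AE y in lebesgue. norm ((indicator ?S y *\<^sub>R f y) * \<psi> y) \<le> norm (B * (indicator ?S y *\<^sub>R f y))"
      using B by (intro always_eventually allI) (simp add: abs_mult mult.commute mult_right_mono)
  qed
  moreover have "(indicator ?S y *\<^sub>R f y) * \<psi> y = indicator D y *\<^sub>R (f y * \<psi> y)" for y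
    using S(2) test_function_eq_0[OF \<psi>, of y] by (cases "y \<in> ?S") (auto simp: indicator_def)
  ultimately show ?thesis by (simp only: set_integrable_def)
qed

lemma T_tensor_locally_integrable:
  assumes "admissible p D L A"
  shows "locally_integrable D (T_tensor p L A i j)"
  unfolding locally_integrable_def
proof (intro allI impI)
  fix K assume K: "compact K \<and> K \<subseteq> D"
  have L: "set_integrable lebesgue K (\<lambda>y. L (A y))"
    using assms K unfolding admissible_def locally_integrable_def by blast
  have AL: "set_integrable lebesgue K (\<lambda>y. A y $ insert i k * pdv (axis (insert j k) 1) L (A y))"
    if "card k = p - 1 \<and> i \<notin> k \<and> j \<notin> k" for k
    using assms K that unfolding admissible_def locally_integrable_def by blast
  have "set_integrable lebesgue K (\<lambda>y. \<Sum>k | card k = p - 1 \<and> i \<notin> k \<and> j \<notin> k.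
      (-1) ^ between_count i j k * (A y $ insert i k * pdv (axis (insert j k) 1) L (A y)))"
    unfolding set_integrable_def scaleR_sum_right
    by (rule Bochner_Integration.integrable_sum, fold set_integrable_def,
        rule set_integrable_mult_right, rule AL) simp
  from set_integral_diff(1)[OF set_integrable_mult_left[of "if i = j then 1 else 0", OF L] this]
  have "set_integrable lebesgue K (\<lambda>y. L (A y) * (if i = j then 1 else 0) -
      (\<Sum>k | card k = p - 1 \<and> i \<notin> k \<and> j \<notin> k.
        (-1) ^ between_count i j k * (A y $ insert i k * pdv (axis (insert j k) 1) L (A y))))" .
  then show "set_integrable lebesgue K (T_tensor p L A i j)"
    by (simp add: T_tensor_def[abs_def] mult.assoc)
qed

text \<open>
  Admissibility moves the derivative inside the integral. Local integrability of the entries of \<open>T\<close>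
  then allows the integral to be split into the distributional pairings.
\<close>

lemma first_variation:
  fixes D :: "(real^'n::{finite,wellorder}) set"
  assumes \<xi>: "\<xi> \<in> test_fields D" and flow: "is_flow_of \<phi> \<xi> D" and D: "open D"
    and L: "smooth_on_coord_subspace (Lam p) L" and A: "\<forall>y\<in>D. A y \<in> Lam p" and p: "1 \<le> p"
    and adm: "admissible p D L A"
  shows "((\<lambda>\<epsilon>. functional D L (pullback p (\<phi> \<epsilon>) A)) has_real_derivative
    (\<Sum>i\<in>UNIV. \<Sum>j\<in>UNIV. distr_pd D j (T_tensor p L A i j) (\<lambda>y. \<xi> y $ i))) (at 0)"
proof -
  let ?N = "\<lambda>i j. pdv (axis j 1) (\<lambda>y. \<xi> y $ i)"
  have "pdv (axis j 1) (\<lambda>y. \<xi> y $ i) \<in> test_functions D" for i j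
    using \<xi> by (intro pdv_test_function) (auto simp: test_fields_def)
  then have int: "set_integrable lebesgue D (\<lambda>y. T_tensor p L A i j y * ?N i j y)" for i j
    by (intro locally_integrable_mult_test_function T_tensor_locally_integrable[OF adm])
  have "((\<lambda>\<epsilon>. LINT y:D|lebesgue. transported_integrand p L A \<phi> \<epsilon> y) has_real_derivative
      (LINT y:D|lebesgue. deriv (\<lambda>\<epsilon>. transported_integrand p L A \<phi> \<epsilon> y) 0)) (at 0)"
    using adm \<xi> flow unfolding admissible_def diff_under_integral_at_0_def by blast
  moreover have "(LINT y:D|lebesgue. deriv (\<lambda>\<epsilon>. transported_integrand p L A \<phi> \<epsilon> y) 0) =
      (LINT y:D|lebesgue. - (\<Sum>i\<in>UNIV. \<Sum>j\<in>UNIV. T_tensor p L A i j y * ?N i j y))"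
    using D A
    by (intro set_lebesgue_integral_cong)
      (auto intro!: DERIV_imp_deriv transported_integrand_has_derivative[OF \<xi> flow D _ L _ p])
  moreover have "\<dots> = (\<Sum>i\<in>UNIV. \<Sum>j\<in>UNIV. distr_pd D j (T_tensor p L A i j) (\<lambda>y. \<xi> y $ i))"
  proof -
    define g where "g i j y = indicator D y *\<^sub>R (T_tensor p L A i j y * ?N i j y)" for i j y
    have g: "integrable lebesgue (g i j)" for i j
      using int unfolding g_def set_integrable_def by blast
    have "(LINT y|lebesgue. (\<Sum>i\<in>UNIV. \<Sum>j\<in>UNIV. g i j y)) =
        (\<Sum>i\<in>UNIV. LINT y|lebesgue. (\<Sum>j\<in>UNIV. g i j y))"
      by (intro Bochner_Integration.integral_sum Bochner_Integration.integrable_sum g)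
    also have "\<dots> = (\<Sum>i\<in>UNIV. \<Sum>j\<in>UNIV. LINT y|lebesgue. g i j y)"
      by (intro sum.cong refl Bochner_Integration.integral_sum g)
    finally show ?thesis
      unfolding distr_pd_def set_lebesgue_integral_def scaleR_minus_right scaleR_sum_right
        Bochner_Integration.integral_minus sum_negf g_def by (rule arg_cong)
  qed
  ultimately show ?thesis
    by (simp add: functional_pullback_eq_transported_integral[OF \<xi> flow D])
qed

lemma zero_test_function: "(\<lambda>_. 0) \<in> test_functions D"
proof -
  have "Ck_on V k (\<lambda>_. 0)" for V :: "'a set" and k
  proof (induction k)
    case (Suc k)
    have "pdv b (\<lambda>_. 0) = (\<lambda>_. 0)" for b :: 'a by (rule ext) (simp add: pdv_def)
    with Suc show ?case by simp
  qed simp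
  then show ?thesis by (simp add: test_functions_def smooth_on_coord_subspace_def support_on_def)
qed

theorem theorem2p1:
  fixes D :: "(real^'n::{finite,wellorder}) set"
    and p :: nat
    and L :: "real^('n set) \<Rightarrow> real"
    and A :: "real^'n::_ \<Rightarrow> real^('n set)"
  assumes "1 \<le> p" and "p \<le> CARD('n) - 1"
    and "open D"
    and "smooth_on_coord_subspace (Lam p) L"
    and "\<forall>y\<in>D. A y \<in> Lam p"
    and "closed_form p D A"
    and "admissible p D L A"
  shows "critical_second_principle p D L A \<longleftrightarrow> distr_divergence_free D (T_tensor p L A)"
proof
  note variation = first_variation[OF _ _ assms(3,4,5,1,7)]
  show "critical_second_principle p D L A" if "distr_divergence_free D (T_tensor p L A)"
    unfolding critical_second_principle_def
  proof (intro ballI allI impI)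
    fix \<xi> \<phi> assume \<xi>: "\<xi> \<in> test_fields D" and flow: "is_flow_of \<phi> \<xi> D"
    have "(\<Sum>j\<in>UNIV. distr_pd D j (T_tensor p L A i j) (\<lambda>y. \<xi> y $ i)) = 0" for i
      using that \<xi> by (simp add: distr_divergence_free_def test_fields_def)
    then show "((\<lambda>\<epsilon>. functional D L (pullback p (\<phi> \<epsilon>) A)) has_real_derivative 0) (at 0)"
      using variation[OF \<xi> flow] by simp
  qed
  show "distr_divergence_free D (T_tensor p L A)" if crit: "critical_second_principle p D L A"
    unfolding distr_divergence_free_def
  proof (intro allI ballI)
    fix i \<psi> assume \<psi>: "\<psi> \<in> test_functions D"
    \<comment> \<open>The field \<open>\<psi> e\<^sub>i\<close> isolates the \<open>i\<close>-th row of \<open>T\<close>.\<close>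
    define \<xi> :: "real^'n::_ \<Rightarrow> real^'n::_" where "\<xi> y = (\<chi> k. if k = i then \<psi> y else 0)" for y
    have comp: "(\<lambda>y. \<xi> y $ k) = (if k = i then \<psi> else (\<lambda>_. 0))" for k by (auto simp: \<xi>_def)
    have "(\<lambda>y. \<xi> y $ k) \<in> test_functions D" for k
      unfolding comp by (simp add: \<psi> zero_test_function)
    then have \<xi>: "\<xi> \<in> test_fields D" by (simp add: test_fields_def)
    obtain K where "C11_field \<xi> (field_derivative \<xi>) K" using test_field_is_C11_field[OF \<xi>] .
    then obtain \<phi> where flow: "is_flow_of \<phi> \<xi> D"
      using C11_field.flow_exists test_field_eq_0[OF \<xi>] by blast
    have "((\<lambda>\<epsilon>. functional D L (pullback p (\<phi> \<epsilon>) A)) has_real_derivative 0) (at 0)"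
      using crit \<xi> flow unfolding critical_second_principle_def by blast
    then have "(\<Sum>k\<in>UNIV. \<Sum>j\<in>UNIV. distr_pd D j (T_tensor p L A k j) (\<lambda>y. \<xi> y $ k)) = 0"
      using variation[OF \<xi> flow] DERIV_unique by blast
    moreover have "distr_pd D j f (\<lambda>_. 0) = 0" for j f
      by (simp add: distr_pd_def pdv_def)
    then have "(\<Sum>j\<in>UNIV. distr_pd D j (T_tensor p L A k j) (\<lambda>y. \<xi> y $ k)) =
        (if k = i then \<Sum>j\<in>UNIV. distr_pd D j (T_tensor p L A i j) \<psi> else 0)" for k
      by (simp add: comp)
    ultimately show "(\<Sum>j\<in>UNIV. distr_pd D j (T_tensor p L A i j) \<psi>) = 0" by simp
  qed
qed

end
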